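(* Let $0\le\rho\le1$, and let $\mathsf R^{(\mathsf{MI})}_{\max}$ be the maximum possible rate (supremum of $\mathsf R(\mathscr C)$) over all $(\mathsf M,n)$ IR schemes $\mathscr C$ that satisfy, for some finite $\alpha\in\mathbb N$, $|\mathcal Q_l|\le\alpha$ and $|\mathcal A_l|\le|\mathcal X|^\beta$ for all $l\in[n]$, and whose MI leakage satisfies $\rho^{(\mathsf{MI})}(\mathscr C)\le\rho$. Then $$\mathsf R^{(\mathsf{MI})}_{\max}\le\left[\frac1{n^{\mathsf M-1}}+2\sum_{m=1}^{\mathsf M-1}\frac1{n^{m-1}}H_b^{-1}(1-\rho)\right]^{-1}.$$
   Context: Notation: $[a]=\{1,\dots,a\}$; entropies in bits; $H_b$ is the binary entropy function and $H_b^{-1}:[0,1]\to[0,\tfrac12]$ its inverse on $[0,\tfrac12]$. $n\ge2$ noncolluding servers each store the same $\mathsf M$ independent files $X^{(1)},\dots,X^{(\mathsf M)}$, each uniform on $\mathcal X^\beta$ for a finite alphabet $\mathcal X$ with $|\mathcal X|\ge2$. The requested index $M$ is uniform on $[\mathsf M]$, independent of the files. An $(\mathsf M,n)$ IR scheme $\mathscr C$ consists of: a random strategy $S$ independent of $M$ and the files; queries $Q_l=\phi_l(M,S)\in\mathcal Q_l$ sent to server $l\in[n]$ (so the queries are independent of the files: $I(X^{(1)},\dots,X^{(\mathsf M)};Q_1,\dots,Q_n)=0$); answer-length functions $\ell_l:\mathcal Q_l\to\{0,1,\dots\}$; answers $A_l=\varphi_l(Q_l,X^{(1)},\dots,X^{(\mathsf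 M)})\in\mathcal A^{\ell_l(Q_l)}$; such that $H(X^{(M)}\mid A_1,\dots,A_n,Q_1,\dots,Q_n,M)=0$. $\mathcal A_l$ denotes the alphabet (set of values) of $A_l$; an answer of length $0$ is deterministic and is identified with a fixed element of $\mathcal A_l$. Rate: $\mathsf R(\mathscr C)=\beta\log_2|\mathcal X|/\mathsf D(\mathscr C)$ with $\mathsf D(\mathscr C)=\log_2|\mathcal A|\sum_{l=1}^n\mathbb E[\ell_l(Q_l)]$. MI leakage: $\rho^{(\mathsf{MI})}(\mathscr C)=\frac1n\sum_{l=1}^nI(M;Q_l)$. The file length $\beta$ and the alphabets $\mathcal X,\mathcal A$ are arbitrary (part of the scheme). *)

theory Defs
  imports "HOL-Probability.Probability"
begin

definition words :: "'a set \<Rightarrow> nat \<Rightarrow> 'a list set" where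
  "words A k = {w. set w \<subseteq> A \<and> length w = k}"

text \<open>
  Throughout, \<open>K\<close> is the number of files, \<open>n\<close> the number of servers, and files and servers are
  indexed by \<open>{1..K}\<close> and \<open>{1..n}\<close>. A list of files is a function on \<open>{1..K}\<close>.
  The alphabets are subsets of the parameter types, so that they range over all nonempty finite
  sets, up to renaming, once the types are infinite. The functions \<open>query\<close>, \<open>answer_length\<close> and
  \<open>answer\<close> take the server as first argument, and \<open>query sc l m s\<close> is the query sent to server \<open>l\<close>
  for requested index \<open>m\<close> and strategy \<open>s\<close>.
\<close>

record ('s, 'q, 'x, 'a) ir_scheme =
  file_alphabet :: "'x set"
  file_length :: nat
  strategy :: "'s measure"
  query_alphabet :: "nat \<Rightarrow> 'q set"
  query :: "nat \<Rightarrow> nat \<Rightarrow> 's \<Rightarrow> 'q"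
  answer_alphabet :: "'a set"
  answer_length :: "nat \<Rightarrow> 'q \<Rightarrow> nat"
  answer :: "nat \<Rightarrow> 'q \<Rightarrow> (nat \<Rightarrow> 'x list) \<Rightarrow> 'a list"

definition file_space :: "('s, 'q, 'x, 'a) ir_scheme \<Rightarrow> 'x list set" where
  "file_space sc = words (file_alphabet sc) (file_length sc)"

text \<open>
  An outcome is a triple \<open>(m, s, x)\<close> of the requested index, the strategy and the files. Being a
  product measure, the law below makes the index, the strategy and all the files independent.
\<close>

definition ir_space ::
  "nat \<Rightarrow> ('s, 'q, 'x, 'a) ir_scheme \<Rightarrow> (nat \<times> 's \<times> (nat \<Rightarrow> 'x list)) measure" where
  "ir_space K sc =
     uniform_count_measure {1..K} \<Otimes>\<^sub>M strategy sc \<Otimes>\<^sub>M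
     (\<Pi>\<^sub>M i\<in>{1..K}. uniform_count_measure (file_space sc))"

definition index_rv :: "nat \<times> 's \<times> (nat \<Rightarrow> 'x list) \<Rightarrow> nat" where
  "index_rv = (\<lambda>(m, s, x). m)"

definition requested_file_rv :: "nat \<times> 's \<times> (nat \<Rightarrow> 'x list) \<Rightarrow> 'x list" where
  "requested_file_rv = (\<lambda>(m, s, x). x m)"

definition query_rv ::
  "('s, 'q, 'x, 'a) ir_scheme \<Rightarrow> nat \<Rightarrow> nat \<times> 's \<times> (nat \<Rightarrow> 'x list) \<Rightarrow> 'q" where
  "query_rv sc l = (\<lambda>(m, s, x). query sc l m s)"

definition answer_rv ::
  "('s, 'q, 'x, 'a) ir_scheme \<Rightarrow> nat \<Rightarrow> nat \<times> 's \<times> (nat \<Rightarrow> 'x list) \<Rightarrow> 'a list" where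
  "answer_rv sc l = (\<lambda>(m, s, x). answer sc l (query sc l m s) x)"

text \<open>
  Mutual information and conditional entropy of finite-valued random variables, in bits. These are
  the library abbreviations \<open>mutual_information_Pow\<close> and \<open>conditional_entropy_Pow\<close> of the locale
  \<open>information_space\<close> at base 2, restated because they are not available outside the locale.
\<close>

definition mutual_info :: "'w measure \<Rightarrow> ('w \<Rightarrow> 'b) \<Rightarrow> ('w \<Rightarrow> 'c) \<Rightarrow> real" where
  "mutual_info P U V =
     prob_space.mutual_information P 2
       (count_space (U ` space P)) (count_space (V ` space P)) U V"

definition cond_entropy :: "'w measure \<Rightarrow> ('w \<Rightarrow> 'b) \<Rightarrow> ('w \<Rightarrow> 'c) \<Rightarrow> real" where
  "cond_entropy P U V =
     prob_space.conditional_entropy P 2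
       (count_space (U ` space P)) (count_space (V ` space P)) U V"

definition is_ir_scheme :: "nat \<Rightarrow> nat \<Rightarrow> ('s, 'q, 'x, 'a) ir_scheme \<Rightarrow> bool" where
  "is_ir_scheme K n sc \<longleftrightarrow>
     finite (file_alphabet sc) \<and> card (file_alphabet sc) \<ge> 2 \<and> file_length sc \<ge> 1 \<and>
     finite (answer_alphabet sc) \<and> answer_alphabet sc \<noteq> {} \<and>
     prob_space (strategy sc) \<and>
     (\<forall>l\<in>{1..n}. \<forall>m\<in>{1..K}.
        query sc l m \<in> strategy sc \<rightarrow>\<^sub>M count_space (query_alphabet sc l)) \<and>
     (\<forall>l\<in>{1..n}. \<forall>q\<in>query_alphabet sc l. \<forall>x \<in> {1..K} \<rightarrow>\<^sub>E file_space sc.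
        answer sc l q x \<in> words (answer_alphabet sc) (answer_length sc l q)) \<and>
     cond_entropy (ir_space K sc) requested_file_rv
       (\<lambda>\<omega>. (\<lambda>l\<in>{1..n}. answer_rv sc l \<omega>, \<lambda>l\<in>{1..n}. query_rv sc l \<omega>, index_rv \<omega>)) = 0"

text \<open>
  The set of values of the answer of server \<open>l\<close>. An answer of length 0 is deterministic and is
  identified with one of the other values, so the empty word does not count as a value of its own.
  (If all answers of server \<open>l\<close> have length 0, the set is empty instead of a singleton; its
  cardinality is only compared from above with a number that is at least 1.)
\<close>

definition answer_values :: "nat \<Rightarrow> ('s, 'q, 'x, 'a) ir_scheme \<Rightarrow> nat \<Rightarrow> 'a list set" where
  "answer_values K sc l =
     {answer sc l q x | q x.
        q \<in> query_alphabet sc l \<and> answer_length sc l q > 0 \<and> x \<in> {1..K} \<rightarrow>\<^sub>E file_space sc}"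

definition download_cost :: "nat \<Rightarrow> nat \<Rightarrow> ('s, 'q, 'x, 'a) ir_scheme \<Rightarrow> real" where
  "download_cost K n sc =
     log 2 (card (answer_alphabet sc)) *
     (\<Sum>l=1..n. \<integral>\<omega>. real (answer_length sc l (query_rv sc l \<omega>)) \<partial>ir_space K sc)"

definition rate :: "nat \<Rightarrow> nat \<Rightarrow> ('s, 'q, 'x, 'a) ir_scheme \<Rightarrow> real" where
  "rate K n sc =
     real (file_length sc) * log 2 (card (file_alphabet sc)) / download_cost K n sc"

definition mi_leakage :: "nat \<Rightarrow> nat \<Rightarrow> ('s, 'q, 'x, 'a) ir_scheme \<Rightarrow> real" where
  "mi_leakage K n sc =
     (1 / real n) * (\<Sum>l=1..n. mutual_info (ir_space K sc) index_rv (query_rv sc l))"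

definition admissible :: "nat \<Rightarrow> nat \<Rightarrow> ('s, 'q, 'x, 'a) ir_scheme \<Rightarrow> bool" where
  "admissible K n sc \<longleftrightarrow>
     (\<exists>\<alpha>::nat. \<forall>l\<in>{1..n}.
        finite (query_alphabet sc l) \<and> card (query_alphabet sc l) \<le> \<alpha> \<and>
        finite (answer_values K sc l) \<and>
        card (answer_values K sc l) \<le> card (file_alphabet sc) ^ file_length sc)"

text \<open>
  The supremum is taken in the extended reals, so that it exists without a prior proof that the
  rates are bounded. The first argument fixes the types that carry the alphabets and strategies.
\<close>

definition max_rate_mi ::
  "('s, 'q, 'x, 'a) ir_scheme itself \<Rightarrow> nat \<Rightarrow> nat \<Rightarrow> real \<Rightarrow> ereal" where
  "max_rate_mi T K n \<rho> =
     (SUP sc \<in> {sc :: ('s, 'q, 'x, 'a) ir_scheme.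
                  is_ir_scheme K n sc \<and> admissible K n sc \<and> mi_leakage K n sc \<le> \<rho>}.
        ereal (rate K n sc))"

text \<open>Here \<open>log 2 0 = 0\<close>, so the usual convention for the endpoints 0 and 1 holds.\<close>

definition binary_entropy :: "real \<Rightarrow> real" where
  "binary_entropy p = - p * log 2 p - (1 - p) * log 2 (1 - p)"

definition binary_entropy_inv :: "real \<Rightarrow> real" where
  "binary_entropy_inv = the_inv_into {0..1/2} binary_entropy"

end

theory Submission
  imports Defs "HOL-Real_Asymp.Real_Asymp"
begin

text \<open>
  Fix an order of the files and let \<open>D\<^sub>j\<close> be the entropy of all answers given the queries and the
  first \<open>j\<close> files when the next file is requested. Decoding the requested file and then keeping one
  answer only, averaged over the servers, gives \<open>D\<^sub>j \<ge> L + (1/n) \<Sum>\<^sub>l H(A\<^sub>l | \<dots>)\<close> with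
  \<open>L = \<beta> log |X|\<close>. The last sum refers to the query law of the file just decoded. Because an answer
  has entropy at most \<open>L\<close>, replacing this law by that of the following file costs at most \<open>L\<close> times
  the total variation distance of the two laws. Hence \<open>D\<^sub>j \<ge> D\<^sub>j\<^sub>+\<^sub>1 / n + L (1 - TV)\<close>, with \<open>TV\<close>
  averaged over the servers, and the recursion ends with \<open>D \<ge> L\<close>.

  Averaging over the cyclic shifts of one order replaces every \<open>TV\<close> by its mean over the servers
  and over the pairs of cyclically adjacent indices. For one pair, \<open>(1 - TV) / 2\<close> is the error
  probability of guessing from the query which of the two indices was requested, so Fano's inequality
  bounds its binary entropy below by 1 minus the information the query carries about that bit. The
  mean of these informations is at most \<open>I(M; Q\<^sub>l)\<close> because conditioning on the adjacent pair cannot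
  increase it. Concavity of the binary entropy concludes.
\<close>

section \<open>Conditional entropy under a uniform distribution\<close>

definition fibre :: "'a set \<Rightarrow> ('a \<Rightarrow> 'b) \<Rightarrow> 'a \<Rightarrow> 'a set" where
  "fibre \<Omega> f x = {y \<in> \<Omega>. f y = f x}"

text \<open>\<open>H(f | g)\<close> in bits for a uniform point of \<Omega>: each summand is minus
  the logarithm of the conditional probability of \<open>f x\<close> given \<open>g x\<close>.
  Summing over points instead of values keeps every fibre nonempty, so no convention for
  \<open>0 log 0\<close> enters.\<close>

definition unif_cond_entropy :: "'a set \<Rightarrow> ('a \<Rightarrow> 'b) \<Rightarrow> ('a \<Rightarrow> 'c) \<Rightarrow> real" where
  "unif_cond_entropy \<Omega> f g =
     (\<Sum>x\<in>\<Omega>. log 2 (card (fibre \<Omega> g x) / card (fibre \<Omega> (\<lambda>y. (f y, g y)) x))) / card \<Omega>"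

lemma fibre_card_pos: "finite \<Omega> \<Longrightarrow> x \<in> \<Omega> \<Longrightarrow> card (fibre \<Omega> f x) > 0"
  by (auto simp: fibre_def card_gt_0_iff)

lemma fibre_card_neq_0 [simp]: "finite \<Omega> \<Longrightarrow> x \<in> \<Omega> \<Longrightarrow> card (fibre \<Omega> f x) \<noteq> 0"
  using fibre_card_pos by fastforce

lemma unif_cond_entropy_nonneg:
  assumes "finite \<Omega>"
  shows "0 \<le> unif_cond_entropy \<Omega> f g"
proof -
  have "0 \<le> log 2 (card (fibre \<Omega> g x) / card (fibre \<Omega> (\<lambda>y. (f y, g y)) x))" if "x \<in> \<Omega>" for x
  proof -
    have "card (fibre \<Omega> (\<lambda>y. (f y, g y)) x) \<le> card (fibre \<Omega> g x)"
      using assms by (intro card_mono) (auto simp: fibre_def)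
    then show ?thesis
      using fibre_card_pos[OF assms that, of "\<lambda>y. (f y, g y)"] by simp
  qed
  then show ?thesis unfolding unif_cond_entropy_def by (intro divide_nonneg_nonneg sum_nonneg) auto
qed

text \<open>Entropy sees only the partitions induced by the two functions. This allows tuples to be
  re-encoded freely below.\<close>

lemma unif_cond_entropy_cong:
  assumes "\<And>x y. x \<in> \<Omega> \<Longrightarrow> y \<in> \<Omega> \<Longrightarrow> f x = f y \<longleftrightarrow> f' x = f' y"
    and "\<And>x y. x \<in> \<Omega> \<Longrightarrow> y \<in> \<Omega> \<Longrightarrow> g x = g y \<longleftrightarrow> g' x = g' y"
  shows "unif_cond_entropy \<Omega> f g = unif_cond_entropy \<Omega> f' g'"
proof -
  have "fibre \<Omega> g x = fibre \<Omega> g' x \<and> fibre \<Omega> (\<lambda>y. (f y, g y)) x = fibre \<Omega> (\<lambda>y. (f' y, g' y)) x"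
    if "x \<in> \<Omega>" for x
    using assms[OF _ that] by (auto simp: fibre_def)
  then show ?thesis unfolding unif_cond_entropy_def by simp
qed

text \<open>The quotients of fibre sizes telescope at every point.\<close>

lemma unif_cond_entropy_chain:
  assumes "finite \<Omega>"
  shows "unif_cond_entropy \<Omega> (\<lambda>x. (f x, h x)) g = unif_cond_entropy \<Omega> f g + unif_cond_entropy \<Omega> h (\<lambda>x. (f x, g x))"
proof -
  have "fibre \<Omega> (\<lambda>y. (h y, f y, g y)) x = fibre \<Omega> (\<lambda>y. ((f y, h y), g y)) x" for x
    by (auto simp: fibre_def)
  then have "(\<Sum>x\<in>\<Omega>. log 2 (card (fibre \<Omega> g x) / card (fibre \<Omega> (\<lambda>y. ((f y, h y), g y)) x))) =
    (\<Sum>x\<in>\<Omega>. log 2 (card (fibre \<Omega> g x) / card (fibre \<Omega> (\<lambda>y. (f y, g y)) x)) +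
      log 2 (card (fibre \<Omega> (\<lambda>y. (f y, g y)) x) / card (fibre \<Omega> (\<lambda>y. (h y, f y, g y)) x)))"
    using assms by (intro sum.cong) (simp_all add: log_divide)
  then show ?thesis
    by (simp add: unif_cond_entropy_def sum.distrib add_divide_distrib)
qed

lemma unif_cond_entropy_determined:
  assumes "finite \<Omega>" "\<And>x y. x \<in> \<Omega> \<Longrightarrow> y \<in> \<Omega> \<Longrightarrow> g x = g y \<Longrightarrow> f x = f y"
  shows "unif_cond_entropy \<Omega> f g = 0"
proof -
  have "fibre \<Omega> (\<lambda>y. (f y, g y)) x = fibre \<Omega> g x" if "x \<in> \<Omega>" for x
    using assms(2)[OF _ that] by (auto simp: fibre_def)
  then show ?thesis using assms(1) by (simp add: unif_cond_entropy_def)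
qed

text \<open>The inverse fibre size makes each attained value count exactly once, which turns a sum
  over points into a sum over values.\<close>

lemma sum_inverse_fibre:
  assumes "finite \<Omega>"
  shows "(\<Sum>x\<in>\<Omega>. c (f x) / card (fibre \<Omega> f x)) = (\<Sum>v\<in>f ` \<Omega>. c v :: real)"
proof -
  have "(\<Sum>x\<in>\<Omega>. c (f x) / card (fibre \<Omega> f x)) =
    (\<Sum>v\<in>f ` \<Omega>. \<Sum>x | x \<in> \<Omega> \<and> f x = v. c (f x) / card (fibre \<Omega> f x))"
    by (rule sum.image_gen[OF assms])
  also have "\<dots> = (\<Sum>v\<in>f ` \<Omega>. \<Sum>x | x \<in> \<Omega> \<and> f x = v. c v / card {x \<in> \<Omega>. f x = v})"
    by (intro sum.cong) (auto simp: fibre_def)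
  also have "\<dots> = (\<Sum>v\<in>f ` \<Omega>. c v)"
  proof (intro sum.cong refl)
    fix v assume "v \<in> f ` \<Omega>"
    then have "card {x \<in> \<Omega>. f x = v} > 0" using assms by (auto simp: card_gt_0_iff)
    then show "(\<Sum>x | x \<in> \<Omega> \<and> f x = v. c v / card {x \<in> \<Omega>. f x = v}) = c v" by simp
  qed
  finally show ?thesis .
qed

text \<open>Sums the tangent bound \<open>ln t \<le> t - 1\<close>. The two entropy inequalities
  below reduce to it by taking for \<open>t\<close> a quotient of two conditional
  probabilities.\<close>

lemma sum_log_le:
  fixes t :: "'a \<Rightarrow> real"
  assumes "\<And>x. x \<in> A \<Longrightarrow> 0 < t x" and "(\<Sum>x\<in>A. t x) \<le> card A"
  shows "(\<Sum>x\<in>A. log 2 (t x)) \<le> 0"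
proof -
  have "(\<Sum>x\<in>A. log 2 (t x)) \<le> (\<Sum>x\<in>A. (t x - 1) / ln 2)"
    using assms(1) by (intro sum_mono) (auto simp: log_def divide_simps ln_le_minus_one)
  also have "\<dots> = ((\<Sum>x\<in>A. t x) - card A) / ln 2"
    by (simp add: sum_subtractf sum_divide_distrib[symmetric])
  also have "\<dots> \<le> 0" using assms(2) by (simp add: divide_nonpos_pos)
  finally show ?thesis .
qed

lemma unif_cond_entropy_le_log_card:
  assumes "finite \<Omega>" "f ` \<Omega> \<subseteq> B" "finite B" "\<Omega> \<noteq> {}"
  shows "unif_cond_entropy \<Omega> f g \<le> log 2 (card B)"
proof -
  let ?fg = "\<lambda>y. (f y, g y)"
  \<comment> \<open>The uniform probability on \<open>B\<close> divided by the conditional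
    probability of \<open>f x\<close> given \<open>g x\<close>.\<close>
  define t where "t x = card (fibre \<Omega> g x) / card (fibre \<Omega> ?fg x) / card B" for x
  have B: "card B > 0" using assms by (auto simp: card_gt_0_iff)
  have "(\<Sum>x\<in>\<Omega>. card (fibre \<Omega> g x) / card (fibre \<Omega> ?fg x)) =
    (\<Sum>x\<in>\<Omega>. real (card {y \<in> \<Omega>. g y = snd (?fg x)}) / card (fibre \<Omega> ?fg x))"
    by (simp add: fibre_def)
  also have "\<dots> = (\<Sum>v\<in>?fg ` \<Omega>. real (card {y \<in> \<Omega>. g y = snd v}))"
    by (rule sum_inverse_fibre[OF assms(1), where c = "\<lambda>v. real (card {y \<in> \<Omega>. g y = snd v})"])
  \<comment> \<open>Passing from the attained pairs to the full product only adds nonnegative terms,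
    and then the sum factors.\<close>
  also have "\<dots> \<le> (\<Sum>v\<in>B \<times> g ` \<Omega>. real (card {y \<in> \<Omega>. g y = snd v}))"
    using assms by (intro sum_mono2) auto
  also have "\<dots> = (\<Sum>b\<in>B. \<Sum>c\<in>g ` \<Omega>. real (card {y \<in> \<Omega>. g y = c}))"
    by (simp only: sum.cartesian_product case_prod_unfold)
  also have "\<dots> = card B * real (card \<Omega>)"
    using sum.image_gen[OF assms(1), of "\<lambda>_. 1::nat" g] by (simp flip: of_nat_sum)
  finally have "(\<Sum>x\<in>\<Omega>. t x) \<le> card \<Omega>"
    unfolding t_def sum_divide_distrib[symmetric] using B by (simp add: divide_simps mult.commute)
  then have "(\<Sum>x\<in>\<Omega>. log 2 (t x)) \<le> 0"
    using B
    by (intro sum_log_le) (auto simp: t_def fibre_card_pos[OF assms(1)])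
  also have "(\<Sum>x\<in>\<Omega>. log 2 (t x)) =
    (\<Sum>x\<in>\<Omega>. log 2 (card (fibre \<Omega> g x) / card (fibre \<Omega> ?fg x))) - card \<Omega> * log 2 (card B)"
  proof -
    have "log 2 (t x) = log 2 (card (fibre \<Omega> g x) / card (fibre \<Omega> ?fg x)) - log 2 (card B)"
      if "x \<in> \<Omega>" for x
      unfolding t_def using B assms(1) that by (subst log_divide) auto
    then show ?thesis by (simp add: sum_subtractf)
  qed
  finally show ?thesis
    using assms(1,4) by (simp add: unif_cond_entropy_def divide_simps card_gt_0_iff mult.commute)
qed

text \<open>The mean of \<open>log 2 (t x)\<close> is the left side minus the right side, that is,
  minus the conditional mutual information of \<open>f\<close> and \<open>h\<close> given
  \<open>g\<close>. Here \<open>t\<close> is the probability of \<open>f\<close> given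
  \<open>g\<close> divided by that of \<open>f\<close> given \<open>h\<close> and
  \<open>g\<close>.\<close>

lemma unif_cond_entropy_cond_le:
  assumes "finite \<Omega>"
  shows "unif_cond_entropy \<Omega> f (\<lambda>x. (h x, g x)) \<le> unif_cond_entropy \<Omega> f g"
proof -
  let ?hg = "\<lambda>y. (h y, g y)" and ?fg = "\<lambda>y. (f y, g y)" and ?fhg = "\<lambda>y. (f y, h y, g y)"
  define t where "t x = real (card (fibre \<Omega> ?hg x)) * card (fibre \<Omega> ?fg x) /
    (card (fibre \<Omega> ?fhg x) * card (fibre \<Omega> g x))" for x
  \<comment> \<open>Rewrites \<open>t\<close> without its factor
    \<open>1 / card (fibre \<Omega> ?fhg x)\<close> as a function of the values, as
    \<open>sum_inverse_fibre\<close> requires.\<close>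
  define c where "c = (\<lambda>(a, b, d). real (card {y \<in> \<Omega>. ?hg y = (b, d)}) *
    card {y \<in> \<Omega>. ?fg y = (a, d)} / card {y \<in> \<Omega>. g y = d})"
  have "(\<Sum>x\<in>\<Omega>. t x) = (\<Sum>x\<in>\<Omega>. c (?fhg x) / card (fibre \<Omega> ?fhg x))"
    by (simp add: c_def t_def fibre_def mult.commute)
  also have "\<dots> = (\<Sum>v\<in>?fhg ` \<Omega>. c v)"
    by (rule sum_inverse_fibre[OF assms])
  \<comment> \<open>The value \<open>b\<close> of \<open>h\<close> is set free while the pair of
    values of \<open>f\<close> and \<open>g\<close> stays an attained one. Summing out
    \<open>b\<close> then cancels the denominator of \<open>c\<close>.\<close>
  also have "\<dots> \<le> (\<Sum>v\<in>(\<lambda>(p, b). (fst p, b, snd p)) ` (?fg ` \<Omega> \<times> h ` \<Omega>). c v)"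
    using assms by (intro sum_mono2) (force simp: c_def image_iff)+
  also have "\<dots> = (\<Sum>v\<in>?fg ` \<Omega> \<times> h ` \<Omega>. c (fst (fst v), snd v, snd (fst v)))"
    by (subst sum.reindex) (auto simp: inj_on_def split_beta)
  also have "\<dots> = (\<Sum>p\<in>?fg ` \<Omega>. \<Sum>b\<in>h ` \<Omega>. c (fst p, b, snd p))"
    by (simp add: sum.cartesian_product split_beta)
  also have "\<dots> = (\<Sum>p\<in>?fg ` \<Omega>. real (card {y \<in> \<Omega>. ?fg y = p}))"
  proof (intro sum.cong refl)
    fix p assume p: "p \<in> ?fg ` \<Omega>"
    then have pos: "card {y \<in> \<Omega>. g y = snd p} > 0" using assms by (auto simp: card_gt_0_iff)
    have "(\<Sum>b\<in>h ` \<Omega>. card {y \<in> \<Omega>. ?hg y = (b, snd p)}) =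
      (\<Sum>b\<in>h ` \<Omega>. card {y \<in> {y \<in> \<Omega>. g y = snd p}. h y = b})"
      by (intro sum.cong refl arg_cong[where f = card]) auto
    also have "\<dots> = card {y \<in> \<Omega>. g y = snd p}"
      using sum.group[of "{y \<in> \<Omega>. g y = snd p}" "h ` \<Omega>" h "\<lambda>_. 1::nat"] assms by auto
    finally have "real (\<Sum>b\<in>h ` \<Omega>. card {y \<in> \<Omega>. ?hg y = (b, snd p)}) =
      card {y \<in> \<Omega>. g y = snd p}" by (rule arg_cong)
    then have "(\<Sum>b\<in>h ` \<Omega>. real (card {y \<in> \<Omega>. ?hg y = (b, snd p)})) =
      card {y \<in> \<Omega>. g y = snd p}" by (simp only: of_nat_sum)
    with pos show "(\<Sum>b\<in>h ` \<Omega>. c (fst p, b, snd p)) = card {y \<in> \<Omega>. ?fg y = p}"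
      by (simp add: c_def prod_eq_iff sum_distrib_right[symmetric] sum_divide_distrib[symmetric])
  qed
  also have "\<dots> = card \<Omega>"
    using sum.image_gen[OF assms, of "\<lambda>_. 1::nat" ?fg] by (simp flip: of_nat_sum)
  finally have "(\<Sum>x\<in>\<Omega>. log 2 (t x)) \<le> 0"
    by (intro sum_log_le) (auto simp: t_def fibre_card_pos[OF assms])
  moreover have "log 2 (t x) = log 2 (card (fibre \<Omega> ?hg x) / card (fibre \<Omega> ?fhg x)) -
      log 2 (card (fibre \<Omega> g x) / card (fibre \<Omega> ?fg x))" if "x \<in> \<Omega>" for x
    using assms that by (simp add: t_def log_divide log_mult)
  ultimately show ?thesis
    by (simp add: unif_cond_entropy_def sum_subtractf divide_right_mono)
qed

section \<open>Entropy of tuples and of independent coordinates\<close>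

lemma unif_cond_entropy_tuple_ge:
  assumes "finite \<Omega>" "l \<in> N"
  shows "unif_cond_entropy \<Omega> (a l) g \<le> unif_cond_entropy \<Omega> (\<lambda>x. \<lambda>i\<in>N. a i x) g"
proof -
  have "unif_cond_entropy \<Omega> (\<lambda>x. \<lambda>i\<in>N. a i x) g = unif_cond_entropy \<Omega> (\<lambda>x. (a l x, \<lambda>i\<in>N. a i x)) g"
    using assms(2) by (intro unif_cond_entropy_cong) (auto simp: restrict_def fun_eq_iff)
  also have "\<dots> \<ge> unif_cond_entropy \<Omega> (a l) g"
    using assms(1) by (simp add: unif_cond_entropy_chain unif_cond_entropy_nonneg)
  finally show ?thesis .
qed

lemma unif_cond_entropy_tuple_le:
  assumes "finite \<Omega>" "finite N"
  shows "unif_cond_entropy \<Omega> (\<lambda>x. \<lambda>i\<in>N. a i x) g \<le> (\<Sum>i\<in>N. unif_cond_entropy \<Omega> (a i) g)"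
  using assms(2)
proof induction
  case empty
  then show ?case using assms(1) by (simp add: unif_cond_entropy_determined)
next
  case (insert l N)
  have "unif_cond_entropy \<Omega> (\<lambda>x. \<lambda>i\<in>insert l N. a i x) g = unif_cond_entropy \<Omega> (\<lambda>x. (\<lambda>i\<in>N. a i x, a l x)) g"
    by (intro unif_cond_entropy_cong) (auto simp: restrict_def fun_eq_iff)
  also have "\<dots> \<le> unif_cond_entropy \<Omega> (\<lambda>x. \<lambda>i\<in>N. a i x) g + unif_cond_entropy \<Omega> (a l) g"
    using assms(1) by (simp add: unif_cond_entropy_chain unif_cond_entropy_cond_le)
  finally show ?case using insert by (simp del: restrict_apply add: add.commute)
qed

text \<open>Independence of the files: fixing one more coordinate divides every fibre by exactly
  \<open>card F\<close>.\<close>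

lemma unif_cond_entropy_coordinate:
  assumes F: "finite F" "F \<noteq> {}" and I: "finite I" "S \<subseteq> I" "j \<in> I" "j \<notin> S"
  shows "unif_cond_entropy (I \<rightarrow>\<^sub>E F) (\<lambda>x. x j) (\<lambda>x. restrict x S) = log 2 (card F)"
proof -
  let ?\<Omega> = "I \<rightarrow>\<^sub>E F"
  have card: "card (fibre ?\<Omega> (\<lambda>x. restrict x S) x) = card F ^ card (I - S)"
    if "x \<in> ?\<Omega>" "S \<subseteq> I" for x S
  proof -
    \<comment> \<open>The fibre is again a product, with the coordinates in \<open>S\<close>
      frozen.\<close>
    have "fibre ?\<Omega> (\<lambda>x. restrict x S) x = PiE I (\<lambda>i. if i \<in> S then {x i} else F)"
      using that by (fastforce simp: fibre_def fun_eq_iff restrict_def PiE_iff extensional_def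
          split: if_splits)
    then have "card (fibre ?\<Omega> (\<lambda>x. restrict x S) x) = (\<Prod>i\<in>I. card (if i \<in> S then {x i} else F))"
      using I by (simp add: card_PiE)
    also have "\<dots> = (\<Prod>i\<in>I - S. card F)"
      using I by (intro prod.mono_neutral_cong_right) auto
    finally show ?thesis by simp
  qed
  have fin: "finite ?\<Omega>" "?\<Omega> \<noteq> {}" using F I by (auto simp: finite_PiE PiE_eq_empty_iff)
  have "card (fibre ?\<Omega> (\<lambda>x. restrict x S) x) / card (fibre ?\<Omega> (\<lambda>y. (y j, restrict y S)) x) = card F"
    if x: "x \<in> ?\<Omega>" for x
  proof -
    have "fibre ?\<Omega> (\<lambda>y. (y j, restrict y S)) x = fibre ?\<Omega> (\<lambda>y. restrict y (insert j S)) x"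
      by (auto simp: fibre_def restrict_def fun_eq_iff)
    moreover have "I - S = insert j (I - insert j S)" using I by auto
    then have "card (I - S) = Suc (card (I - insert j S))"
      using I by (metis Diff_iff card_insert_disjoint finite_Diff insertI1)
    moreover have "real (card F ^ Suc k) / real (card F ^ k) = card F" for k
      using F by simp
    moreover have "insert j S \<subseteq> I" using I by simp
    ultimately show ?thesis using card[OF x I(2)] card[OF x, of "insert j S"] by (simp only:)
  qed
  then show ?thesis using fin by (simp add: unif_cond_entropy_def)
qed

section \<open>The binary entropy function\<close>

lemma binary_entropy_0 [simp]: "binary_entropy 0 = 0"
  by (simp add: binary_entropy_def)

lemma binary_entropy_half [simp]: "binary_entropy (1/2) = 1"
  by (simp add: binary_entropy_def log_divide)

lemma binary_entropy_reflect: "binary_entropy (1 - p) = binary_entropy p"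
  by (simp add: binary_entropy_def algebra_simps)

lemma binary_entropy_ln: "binary_entropy p = - (p * ln p + (1 - p) * ln (1 - p)) / ln 2"
  by (simp add: binary_entropy_def log_def diff_divide_distrib)

lemma continuous_on_binary_entropy: "continuous_on {0..1/2} binary_entropy"
proof -
  \<comment> \<open>Only the point 0 is delicate: there the value given by
    \<open>log 2 0 = 0\<close> is the limit from the right.\<close>
  have "((\<lambda>x. x * log 2 x) \<longlongrightarrow> 0) (at_right (0::real))"
    by real_asymp
  then have 0: "continuous (at 0 within {0..1/2}) (\<lambda>x::real. x * log 2 x)"
    by (simp add: continuous_within at_within_Icc_at_right)
  have "continuous_on {0..1/2} (\<lambda>x::real. x * log 2 x)"
    unfolding continuous_on_eq_continuous_within
  proof
    fix x :: real assume "x \<in> {0..1/2}"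
    then show "continuous (at x within {0..1/2}) (\<lambda>x. x * log 2 x)"
      using 0 by (cases "x = 0") (auto intro!: continuous_intros)
  qed
  moreover have "continuous_on {0..1/2} (\<lambda>x::real. (1 - x) * log 2 (1 - x))"
    by (intro continuous_intros) auto
  ultimately have "continuous_on {0..1/2} (\<lambda>x::real. - (x * log 2 x) - (1 - x) * log 2 (1 - x))"
    by (intro continuous_on_diff continuous_on_minus)
  then show ?thesis
    by (simp add: binary_entropy_def[abs_def])
qed

lemma strict_mono_on_binary_entropy: "strict_mono_on {0..1/2} binary_entropy"
proof (rule strict_mono_onI)
  fix x y :: real assume xy: "x \<in> {0..1/2}" "y \<in> {0..1/2}" "x < y"
  show "binary_entropy x < binary_entropy y"
  \<comment> \<open>The open form asks for a derivative in the interior only; at 0 the slope is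
    infinite.\<close>
  proof (rule DERIV_pos_imp_increasing_open[OF \<open>x < y\<close>])
    show "continuous_on {x..y} binary_entropy"
      using xy by (intro continuous_on_subset[OF continuous_on_binary_entropy]) auto
    fix z assume z: "x < z" "z < y"
    have "(binary_entropy has_real_derivative (ln (1 - z) - ln z) / ln 2) (at z)"
      unfolding binary_entropy_ln[abs_def] using z xy
      by (auto intro!: derivative_eq_intros)
    moreover have "(ln (1 - z) - ln z) / ln 2 > 0" using z xy by simp
    ultimately show "\<exists>d. (binary_entropy has_real_derivative d) (at z) \<and> d > 0"
      by blast
  qed
qed

text \<open>Existence of a preimage comes from the intermediate value theorem, uniqueness from
  strict monotonicity.\<close>

lemma binary_entropy_inv:
  assumes "0 \<le> t" "t \<le> 1"
  shows "0 \<le> binary_entropy_inv t" "binary_entropy_inv t \<le> 1/2"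
    "binary_entropy (binary_entropy_inv t) = t"
proof -
  obtain p where p: "0 \<le> p" "p \<le> 1/2" "binary_entropy p = t"
    using IVT'[of binary_entropy 0 t "1/2"] assms continuous_on_binary_entropy by auto
  have "binary_entropy_inv t = p"
    unfolding binary_entropy_inv_def
    by (rule the_inv_into_f_eq[OF strict_mono_on_imp_inj_on[OF strict_mono_on_binary_entropy]])
      (use p in auto)
  with p show "0 \<le> binary_entropy_inv t" "binary_entropy_inv t \<le> 1/2"
    "binary_entropy (binary_entropy_inv t) = t" by auto
qed

lemma binary_entropy_inv_le:
  assumes "0 \<le> t" "t \<le> binary_entropy z" "0 \<le> z" "z \<le> 1/2"
  shows "binary_entropy_inv t \<le> z"
proof (rule ccontr)
  assume "\<not> binary_entropy_inv t \<le> z"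
  \<comment> \<open>Forces \<open>t \<le> 1\<close>, so that the inverse laws apply to
    \<open>t\<close>.\<close>
  moreover have "binary_entropy z \<le> 1"
    using strict_mono_on_leD[OF strict_mono_on_binary_entropy, of z "1/2"] assms by auto
  ultimately show False
    using strict_mono_onD[OF strict_mono_on_binary_entropy, of z "binary_entropy_inv t"]
      binary_entropy_inv[of t] assms by auto
qed

text \<open>One term of Gibbs' inequality, from \<open>ln x \<le> x - 1\<close> at
  \<open>x = r / p\<close>. The corrections \<open>(r - p) / ln 2\<close> cancel in sums over two
  families of equal total mass.\<close>

lemma gibbs_term:
  assumes "0 \<le> (p::real)" "0 < r"
  shows "- p * log 2 p \<le> - p * log 2 r + (r - p) / ln 2"
proof (cases "p = 0")
  case False
  then have "p * ln (r / p) \<le> p * (r / p - 1)"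
    using assms by (intro mult_left_mono ln_le_minus_one) auto
  then have "- p * ln p \<le> - p * ln r + (r - p)"
    using assms False by (simp add: ln_div right_diff_distrib)
  then have "- p * ln p / ln 2 \<le> (- p * ln r + (r - p)) / ln 2"
    by (intro divide_right_mono) auto
  then show ?thesis by (simp add: log_def add_divide_distrib diff_divide_distrib)
qed (use assms in auto)

text \<open>The graph lies below its tangent at the mean \<open>z\<close>. The tangent is the cross
  entropy against \<open>z\<close>, which is affine in \<open>p\<close> and equals the binary
  entropy at \<open>p = z\<close>.\<close>

lemma binary_entropy_jensen:
  assumes w: "finite A" "\<And>i. i \<in> A \<Longrightarrow> 0 \<le> w i" "(\<Sum>i\<in>A. w i) = 1"
    and t: "\<And>i. i \<in> A \<Longrightarrow> 0 \<le> t i \<and> t i \<le> 1"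
  shows "(\<Sum>i\<in>A. w i * binary_entropy (t i)) \<le> binary_entropy (\<Sum>i\<in>A. w i * t i)"
proof -
  define z where "z = (\<Sum>i\<in>A. w i * t i)"
  have z1: "1 - z = (\<Sum>i\<in>A. w i * (1 - t i))"
    by (simp add: z_def w(3) right_diff_distrib sum_subtractf)
  \<comment> \<open>At the endpoints there is no tangent, but every \<open>t i\<close> of nonzero
    weight equals \<open>z\<close> there, so both sides vanish.\<close>
  consider "z = 0" | "z = 1" | "0 < z" "z < 1"
    using w t sum_nonneg[of A "\<lambda>i. w i * t i"] sum_nonneg[of A "\<lambda>i. w i * (1 - t i)"] z1 z_def
    by fastforce
  then show ?thesis
  proof cases
    case 1
    then have "w i * t i = 0" if "i \<in> A" for i
      using w t that by (auto simp: z_def sum_nonneg_eq_0_iff)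
    then have "(\<Sum>i\<in>A. w i * binary_entropy (t i)) = 0" by (intro sum.neutral) fastforce
    then show ?thesis using 1 by (simp add: z_def)
  next
    case 2
    then have "w i * (1 - t i) = 0" if "i \<in> A" for i
      using w t that z1 by (auto simp: sum_nonneg_eq_0_iff)
    then have "(\<Sum>i\<in>A. w i * binary_entropy (t i)) = 0"
      by (intro sum.neutral) (fastforce simp: binary_entropy_def)
    then show ?thesis using 2 by (simp add: z_def binary_entropy_def)
  next
    case 3
    have "binary_entropy p \<le> - p * log 2 z - (1 - p) * log 2 (1 - z)" if "0 \<le> p" "p \<le> 1" for p
    proof -
      have "(z - p) / ln 2 + ((1 - z) - (1 - p)) / ln 2 = 0"
        by (simp flip: add_divide_distrib)
      then show ?thesis
        using gibbs_term[of p z] gibbs_term[of "1 - p" "1 - z"] that 3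
        unfolding binary_entropy_def by linarith
    qed
    then have "(\<Sum>i\<in>A. w i * binary_entropy (t i)) \<le>
      (\<Sum>i\<in>A. w i * (- t i * log 2 z - (1 - t i) * log 2 (1 - z)))"
      using w t by (intro sum_mono mult_left_mono) auto
    also have "\<dots> = - log 2 z * (\<Sum>i\<in>A. w i * t i) - log 2 (1 - z) * (\<Sum>i\<in>A. w i * (1 - t i))"
      by (simp add: sum_distrib_left sum_subtractf[symmetric] algebra_simps)
    also have "\<dots> = binary_entropy z"
      unfolding z1[symmetric] z_def[symmetric] by (simp add: binary_entropy_def)
    finally show ?thesis by (simp add: z_def)
  qed
qed

text \<open>With \<open>r = (p + p') / 2\<close>, the posterior error of a uniform bit is \<open>min p p' / (2 r)\<close>.\<close>

lemma binary_entropy_posterior: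
  assumes "0 \<le> p" "0 \<le> p'"
  shows "(p + p') / 2 * binary_entropy (min p p' / (p + p')) =
    (p + p') / 2 + (p + p') / 2 * log 2 ((p + p') / 2) - (p * log 2 p + p' * log 2 p') / 2"
proof (cases "p + p' = 0")
  case True
  then have "p = 0" "p' = 0" using assms by auto
  then show ?thesis by simp
next
  case False
  have *: "1 - p / (p + p') = p' / (p + p')" using False by (simp add: field_simps)
  \<comment> \<open>By symmetry of the binary entropy, the smaller posterior may be replaced by that
    of \<open>p\<close>.\<close>
  have m: "binary_entropy (min p p' / (p + p')) = binary_entropy (p / (p + p'))"
    using binary_entropy_reflect[of "p / (p + p')"] unfolding * by (cases "p \<le> p'") auto
  have lg: "q * log 2 (q / (p + p')) = q * log 2 q - q * log 2 (p + p')" if "0 \<le> q" for q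
    using False assms that by (cases "q = 0") (auto simp: log_divide algebra_simps)
  have "(p + p') * binary_entropy (p / (p + p')) =
     - (p * log 2 p - p * log 2 (p + p')) - (p' * log 2 p' - p' * log 2 (p + p'))"
  proof -
    have c: "(p + p') * (q / (p + p') * y) = q * y" for q y using False by simp
    have "(p + p') * binary_entropy (p / (p + p')) =
      - ((p + p') * (p / (p + p') * log 2 (p / (p + p')))) -
        (p + p') * (p' / (p + p') * log 2 (p' / (p + p')))"
      unfolding binary_entropy_def * by (simp only: right_diff_distrib mult_minus_left mult_minus_right)
    then show ?thesis unfolding c lg[OF assms(1)] lg[OF assms(2)] .
  qed
  \<comment> \<open>The summand 1 is the one bit of prior uncertainty.\<close>
  moreover have l: "log 2 (p + p') = log 2 ((p + p') / 2) + 1"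
    using False assms by (simp add: log_divide)
  moreover have "(p + p') / 2 * b = (p + p') * b / 2" for b
    by simp
  ultimately show ?thesis unfolding m l by (simp add: field_simps)
qed

section \<open>From leakage to overlap of the query laws\<close>

text \<open>Adjacent indices in a cyclic order suffice: if \<open>m\<close> is uniform, so is its successor, and the
  midpoints \<open>(P m + P (\<sigma> m)) / 2\<close> average to the same mixture as the \<open>P m\<close>.\<close>

lemma overlap_fano:
  fixes P :: "'l \<Rightarrow> 'm \<Rightarrow> 'q \<Rightarrow> real" and \<sigma> :: "'m \<Rightarrow> 'm" and \<rho> :: real
  assumes fin: "finite L" "L \<noteq> {}" "finite I" "I \<noteq> {}" "\<And>l. l \<in> L \<Longrightarrow> finite (Q l)"
    and \<sigma>: "bij_betw \<sigma> I I"
    and P0: "\<And>l m q. 0 \<le> P l m q"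
    and P1: "\<And>l m. l \<in> L \<Longrightarrow> m \<in> I \<Longrightarrow> (\<Sum>q\<in>Q l. P l m q) = 1"
    and leak: "(\<Sum>l\<in>L. \<Sum>m\<in>I. \<Sum>q\<in>Q l.
        P l m q * log 2 (P l m q / ((\<Sum>m'\<in>I. P l m' q) / card I))) \<le> \<rho> * (card L * card I)"
    and \<rho>: "0 \<le> \<rho>" "\<rho> \<le> 1"
  shows "2 * binary_entropy_inv (1 - \<rho>) * (card L * card I) \<le>
    (\<Sum>l\<in>L. \<Sum>m\<in>I. \<Sum>q\<in>Q l. min (P l m q) (P l (\<sigma> m) q))"
proof -
  define c where "c = real (card L * card I)"
  have c: "c > 0" using fin by (simp add: c_def card_gt_0_iff)
  \<comment> \<open>\<open>R\<close> is the query law when \<open>m\<close> and its successor are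
    equally likely; \<open>B\<close> is the mixture over all indices.\<close>
  define R where "R l m q = (P l m q + P l (\<sigma> m) q) / 2" for l m q
  define B where "B l q = (\<Sum>m\<in>I. P l m q) / card I" for l q
  define ov where "ov l m q = min (P l m q) (P l (\<sigma> m) q)" for l m q
  have R0: "0 \<le> R l m q" for l m q using P0 by (simp add: R_def)
  have ov: "0 \<le> ov l m q" "ov l m q \<le> R l m q" for l m q
    using P0 by (auto simp: ov_def R_def min_def field_simps)
  have \<sigma>I: "\<sigma> m \<in> I" if "m \<in> I" for m using \<sigma> that by (auto simp: bij_betw_def)
  have shift: "(\<Sum>m\<in>I. f (\<sigma> m)) = (\<Sum>m\<in>I. f m)" for f :: "'m \<Rightarrow> real"
    by (rule sum.reindex_bij_betw[OF \<sigma>])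
  have sumR: "(\<Sum>m\<in>I. R l m q) = (\<Sum>m\<in>I. P l m q)" for l q
    by (simp add: R_def sum_divide_distrib[symmetric] sum.distrib shift[of "\<lambda>m. P l m q"])
  have sumRq: "(\<Sum>q\<in>Q l. R l m q) = 1" if "l \<in> L" "m \<in> I" for l m
    using P1 that \<sigma>I by (simp add: R_def sum_divide_distrib[symmetric] sum.distrib)
  define A where "A = (SIGMA l:L. I \<times> Q l)"
  have sumA: "(\<Sum>(l, m, q)\<in>A. f l m q) = (\<Sum>l\<in>L. \<Sum>m\<in>I. \<Sum>q\<in>Q l. f l m q)"
    for f :: "'l \<Rightarrow> 'm \<Rightarrow> 'q \<Rightarrow> real"
  proof -
    have "(\<Sum>(l, m, q)\<in>A. f l m q) = (\<Sum>l\<in>L. \<Sum>(m, q)\<in>I \<times> Q l. f l m q)"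
      unfolding A_def using fin by (subst sum.Sigma) auto
    also have "\<dots> = (\<Sum>l\<in>L. \<Sum>m\<in>I. \<Sum>q\<in>Q l. f l m q)"
      by (simp add: sum.cartesian_product)
    finally show ?thesis .
  qed
  have swap: "(\<Sum>m\<in>I. \<Sum>q\<in>Q l. f m q) = (\<Sum>q\<in>Q l. \<Sum>m\<in>I. f m q)"
    for l and f :: "'m \<Rightarrow> 'q \<Rightarrow> real"
    by (rule sum.swap)
  \<comment> \<open>Fano's inequality at one query, summed over the index. The left side is the
    weighted posterior entropy of the bit that tells \<open>m\<close> from
    \<open>\<sigma> m\<close>; the subtracted sum is the contribution of \<open>q\<close> to the
    leakage.\<close>
  have JS: "(\<Sum>m\<in>I. R l m q * binary_entropy (ov l m q / (P l m q + P l (\<sigma> m) q))) \<ge>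
    (\<Sum>m\<in>I. R l m q) - (\<Sum>m\<in>I. P l m q * log 2 (P l m q / B l q))" for l q
  proof (cases "(\<Sum>m\<in>I. P l m q) = 0")
    case True
    then have "P l m q = 0" if "m \<in> I" for m
      using that fin P0 by (simp add: sum_nonneg_eq_0_iff)
    then show ?thesis using \<sigma>I by (simp add: R_def)
  next
    case False
    then have B: "0 < B l q"
      using fin P0 by (auto simp: B_def card_gt_0_iff less_le sum_nonneg)
    have cB: "(\<Sum>m\<in>I. P l m q) = card I * B l q"
      using fin by (simp add: B_def)
    \<comment> \<open>Gibbs' inequality against the constant \<open>B l q\<close>. The corrections
      cancel because the \<open>R l m q\<close> sum to \<open>card I * B l q\<close>.\<close>
    have "(\<Sum>m\<in>I. - R l m q * log 2 (R l m q)) \<le>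
      (\<Sum>m\<in>I. - R l m q * log 2 (B l q) + (B l q - R l m q) / ln 2)"
      by (intro sum_mono gibbs_term R0 B)
    also have "\<dots> = - (\<Sum>m\<in>I. R l m q) * log 2 (B l q) + (card I * B l q - (\<Sum>m\<in>I. R l m q)) / ln 2"
      by (simp add: sum.distrib sum_distrib_right sum_negf sum_subtractf sum_divide_distrib[symmetric])
    also have "\<dots> = - (\<Sum>m\<in>I. P l m q) * log 2 (B l q)"
      by (simp add: sumR cB)
    finally have 1: "(\<Sum>m\<in>I. P l m q) * log 2 (B l q) \<le> (\<Sum>m\<in>I. R l m q * log 2 (R l m q))"
      by (simp add: sum_negf)
    have "P l m q * log 2 (P l m q / B l q) = P l m q * log 2 (P l m q) - P l m q * log 2 (B l q)" for m
      using B P0[of l m q] by (cases "P l m q = 0") (auto simp: log_divide algebra_simps less_le)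
    then have 2: "(\<Sum>m\<in>I. P l m q * log 2 (P l m q / B l q)) =
      (\<Sum>m\<in>I. P l m q * log 2 (P l m q)) - (\<Sum>m\<in>I. P l m q) * log 2 (B l q)"
      by (simp add: sum_subtractf sum_distrib_right)
    have "(\<Sum>m\<in>I. R l m q * binary_entropy (ov l m q / (P l m q + P l (\<sigma> m) q))) =
      (\<Sum>m\<in>I. R l m q + R l m q * log 2 (R l m q) -
        (P l m q * log 2 (P l m q) + P l (\<sigma> m) q * log 2 (P l (\<sigma> m) q)) / 2)"
      unfolding R_def ov_def by (intro sum.cong refl binary_entropy_posterior P0)
    also have "\<dots> = (\<Sum>m\<in>I. R l m q) + (\<Sum>m\<in>I. R l m q * log 2 (R l m q)) -
      (\<Sum>m\<in>I. P l m q * log 2 (P l m q))"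
      by (simp add: sum.distrib sum_subtractf sum_divide_distrib[symmetric]
          shift[of "\<lambda>m. P l m q * log 2 (P l m q)"])
    finally show ?thesis using 1 2 by simp
  qed
  \<comment> \<open>\<open>w\<close> is the joint law of server, index and query, and
    \<open>t\<close> the posterior error, so one use of concavity averages over all three.\<close>
  define w where "w = (\<lambda>(l, m, q). R l m q / c)"
  define t where "t = (\<lambda>(l, m, q). ov l m q / (P l m q + P l (\<sigma> m) q))"
  have w1: "(\<Sum>i\<in>A. w i) = 1"
    using c unfolding w_def
    by (simp add: sumA sum_divide_distrib[symmetric] sumRq) (simp add: c_def)
  have "(1 - \<rho>) * c \<le> c - (\<Sum>l\<in>L. \<Sum>m\<in>I. \<Sum>q\<in>Q l. P l m q * log 2 (P l m q / B l q))"
    using leak by (simp add: B_def c_def algebra_simps)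
  also have "\<dots> = (\<Sum>l\<in>L. \<Sum>q\<in>Q l. (\<Sum>m\<in>I. R l m q) - (\<Sum>m\<in>I. P l m q * log 2 (P l m q / B l q)))"
  proof -
    have "(\<Sum>l\<in>L. \<Sum>q\<in>Q l. \<Sum>m\<in>I. R l m q) = c"
      unfolding swap[symmetric] by (simp add: sumRq c_def)
    then show ?thesis unfolding sum_subtractf swap by simp
  qed
  also have "\<dots> \<le> (\<Sum>l\<in>L. \<Sum>q\<in>Q l. \<Sum>m\<in>I.
      R l m q * binary_entropy (ov l m q / (P l m q + P l (\<sigma> m) q)))"
    by (intro sum_mono JS)
  also have "\<dots> = (\<Sum>i\<in>A. w i * binary_entropy (t i)) * c"
  proof -
    have "(\<Sum>i\<in>A. w i * binary_entropy (t i)) * c =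
      (\<Sum>(l, m, q)\<in>A. R l m q * binary_entropy (ov l m q / (P l m q + P l (\<sigma> m) q)))"
      unfolding sum_distrib_right using c by (intro sum.cong) (auto simp: w_def t_def)
    then show ?thesis unfolding sumA swap by simp
  qed
  finally have "1 - \<rho> \<le> (\<Sum>i\<in>A. w i * binary_entropy (t i))"
    using c by simp
  also have "\<dots> \<le> binary_entropy (\<Sum>i\<in>A. w i * t i)"
  proof (rule binary_entropy_jensen[OF _ _ w1])
    show "finite A" unfolding A_def using fin by auto
    fix i :: "'l \<times> 'm \<times> 'q"
    obtain l m q where i: "i = (l, m, q)" by (cases i) auto
    show "0 \<le> w i" using R0 c by (simp add: w_def i)
    have "ov l m q \<le> P l m q + P l (\<sigma> m) q" using P0[of l m q] P0[of l "\<sigma> m" q] by (simp add: ov_def)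
    then show "0 \<le> t i \<and> t i \<le> 1"
      using ov(1)[of l m q] by (auto simp: t_def i divide_le_eq_1)
  qed
  finally have H: "1 - \<rho> \<le> binary_entropy (\<Sum>i\<in>A. w i * t i)" .
  \<comment> \<open>The denominator of \<open>t\<close> is twice \<open>R\<close>. If it is 0, both
    sides are 0 by the value of division by 0.\<close>
  have "w (l, m, q) * t (l, m, q) = ov l m q / 2 / c" for l m q
    using P0[of l m q] P0[of l "\<sigma> m" q] ov[of l m q]
    by (cases "P l m q + P l (\<sigma> m) q = 0") (auto simp: w_def t_def R_def)
  then have "(\<Sum>i\<in>A. w i * t i) = (\<Sum>(l, m, q)\<in>A. ov l m q / 2 / c)"
    by (intro sum.cong) auto
  also have "\<dots> = (\<Sum>l\<in>L. \<Sum>m\<in>I. \<Sum>q\<in>Q l. ov l m q) / 2 / c"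
    by (simp add: sumA sum_divide_distrib)
  finally have wt: "(\<Sum>i\<in>A. w i * t i) = (\<Sum>l\<in>L. \<Sum>m\<in>I. \<Sum>q\<in>Q l. ov l m q) / 2 / c" .
  \<comment> \<open>Keeps the mean error at most \<open>1/2\<close>, in the range where the entropy
    can be inverted.\<close>
  have "(\<Sum>l\<in>L. \<Sum>m\<in>I. \<Sum>q\<in>Q l. ov l m q) \<le> (\<Sum>l\<in>L. \<Sum>m\<in>I. \<Sum>q\<in>Q l. R l m q)"
    by (intro sum_mono ov)
  also have "\<dots> = c" by (simp add: sumRq c_def)
  finally have "binary_entropy_inv (1 - \<rho>) \<le> (\<Sum>i\<in>A. w i * t i)"
    using H \<rho> ov c unfolding wt
    by (intro binary_entropy_inv_le) (auto simp: sum_nonneg field_simps)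
  then show ?thesis
    using c unfolding wt c_def[symmetric] ov_def[symmetric] by (simp add: field_simps)
qed

section \<open>The recursion over the files\<close>

text \<open>\<open>W m\<close> is the joint law of the query vector when the requested index is \<open>m\<close>.\<close>

locale finite_retrieval =
  fixes F :: "'x set" and I :: "'m set" and N :: "'l set" and Q :: "'l \<Rightarrow> 'q set"
    and W :: "'m \<Rightarrow> ('l \<Rightarrow> 'q) \<Rightarrow> real" and a :: "'l \<Rightarrow> 'q \<Rightarrow> ('m \<Rightarrow> 'x) \<Rightarrow> 'b"
  assumes fin: "finite F" "F \<noteq> {}" "finite I" "I \<noteq> {}" "finite N" "N \<noteq> {}"
      "\<And>l. l \<in> N \<Longrightarrow> finite (Q l)"
    and W_nonneg: "\<And>m v. 0 \<le> W m v"
    and W_sum: "\<And>m. m \<in> I \<Longrightarrow> (\<Sum>v\<in>Pi\<^sub>E N Q. W m v) = 1"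
    and decode: "\<And>m v x y. m \<in> I \<Longrightarrow> v \<in> Pi\<^sub>E N Q \<Longrightarrow> W m v > 0 \<Longrightarrow>
      x \<in> I \<rightarrow>\<^sub>E F \<Longrightarrow> y \<in> I \<rightarrow>\<^sub>E F \<Longrightarrow> (\<And>l. l \<in> N \<Longrightarrow> a l (v l) x = a l (v l) y) \<Longrightarrow> x m = y m"
    and card_answers: "\<And>l q. l \<in> N \<Longrightarrow> q \<in> Q l \<Longrightarrow> card (a l q ` (I \<rightarrow>\<^sub>E F)) \<le> card F"
begin

abbreviation "\<Omega> \<equiv> I \<rightarrow>\<^sub>E F"
abbreviation "L \<equiv> log 2 (card F)"

text \<open>The law of the single query to server \<open>l\<close>. Leakage and expected cost depend
  on \<open>W\<close> only through these laws.\<close>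

definition marg :: "'l \<Rightarrow> 'm \<Rightarrow> 'q \<Rightarrow> real" where
  "marg l m q = (\<Sum>v | v \<in> Pi\<^sub>E N Q \<and> v l = q. W m v)"

text \<open>For indices in \<open>I\<close> this is \<open>card N\<close> minus the sum over the
  servers of the total variation distances between the two query laws.\<close>

definition overlap :: "'m \<Rightarrow> 'm \<Rightarrow> real" where
  "overlap m m' = (\<Sum>l\<in>N. \<Sum>q\<in>Q l. min (marg l m q) (marg l m' q))"

text \<open>This is \<open>H(A\<^sub>1, \<dots>, A\<^sub>n | Q, X (s 0), \<dots>, X (s (j - 1)))\<close> when the
  requested index is \<open>s j\<close>.\<close>

definition residual :: "(nat \<Rightarrow> 'm) \<Rightarrow> nat \<Rightarrow> real" where
  "residual s j = (\<Sum>v\<in>Pi\<^sub>E N Q. W (s j) v *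
     unif_cond_entropy \<Omega> (\<lambda>x. \<lambda>l\<in>N. a l (v l) x) (\<lambda>x. restrict x (s ` {..<j})))"

lemma finite_\<Omega>: "finite \<Omega>" "\<Omega> \<noteq> {}"
  using fin by (auto simp: finite_PiE PiE_eq_empty_iff)

lemma finite_V: "finite (Pi\<^sub>E N Q)"
  using fin by (auto intro: finite_PiE)

lemma L_nonneg: "0 \<le> L"
  using fin(1,2) by (simp add: card_gt_0_iff Suc_le_eq)

lemma marg_nonneg: "0 \<le> marg l m q"
  unfolding marg_def by (intro sum_nonneg W_nonneg)

lemma sum_W_marg:
  assumes "l \<in> N"
  shows "(\<Sum>v\<in>Pi\<^sub>E N Q. W m v * f (v l)) = (\<Sum>q\<in>Q l. marg l m q * f q)"
proof -
  have "(\<Sum>v\<in>Pi\<^sub>E N Q. W m v * f (v l)) =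
      (\<Sum>q\<in>Q l. \<Sum>v | v \<in> Pi\<^sub>E N Q \<and> v l = q. W m v * f (v l))"
    using assms fin finite_V by (intro sum.group[symmetric]) auto
  also have "\<dots> = (\<Sum>q\<in>Q l. marg l m q * f q)"
    unfolding marg_def sum_distrib_right by (intro sum.cong) auto
  finally show ?thesis .
qed

lemma marg_sum: "l \<in> N \<Longrightarrow> m \<in> I \<Longrightarrow> (\<Sum>q\<in>Q l. marg l m q) = 1"
  using sum_W_marg[of l m "\<lambda>_. 1"] W_sum by simp

lemma answers_entropy_le:
  "unif_cond_entropy \<Omega> (\<lambda>x. \<lambda>l\<in>N. a l (v l) x) g \<le> (\<Sum>l\<in>N. unif_cond_entropy \<Omega> (a l (v l)) g)"
  using finite_\<Omega>(1) fin(5) by (rule unif_cond_entropy_tuple_le)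

text \<open>The answers determine the file \<open>s j\<close>, so it can be joined to them for free.
  The chain rule then splits off its entropy, which is \<open>L\<close> by independence of the
  earlier files, and leaves one more file in the condition.\<close>

lemma residual_ge:
  assumes s: "s ` {..<Suc j} \<subseteq> I" "inj_on s {..<Suc j}"
  shows "residual s j \<ge> L + (\<Sum>v\<in>Pi\<^sub>E N Q. W (s j) v *
     unif_cond_entropy \<Omega> (\<lambda>x. \<lambda>l\<in>N. a l (v l) x) (\<lambda>x. restrict x (s ` {..<Suc j})))"
proof -
  let ?A = "\<lambda>v x. \<lambda>l\<in>N. a l (v l) x" and ?g = "\<lambda>j x. restrict x (s ` {..<j})"
  have sj: "s j \<in> I" "s j \<notin> s ` {..<j}" "s ` {..<j} \<subseteq> I"
    using s by (auto simp: inj_on_def) force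
  \<comment> \<open>Decodability is known only for query vectors of positive probability; for the
    others the weight annuls both sides.\<close>
  have eq: "W (s j) v * (L + unif_cond_entropy \<Omega> (?A v) (?g (Suc j))) = W (s j) v * unif_cond_entropy \<Omega> (?A v) (?g j)"
    if v: "v \<in> Pi\<^sub>E N Q" for v
  proof (cases "W (s j) v = 0")
    case False
    then have W: "W (s j) v > 0" using W_nonneg[of "s j" v] by simp
    have dec: "x (s j) = y (s j)" if "x \<in> \<Omega>" "y \<in> \<Omega>" "?A v x = ?A v y" for x y
    proof (rule decode[OF sj(1) v W that(1,2)])
      fix l assume "l \<in> N"
      then show "a l (v l) x = a l (v l) y" using fun_cong[OF that(3), of l] by simp
    qed
    have "unif_cond_entropy \<Omega> (?A v) (?g j) = unif_cond_entropy \<Omega> (\<lambda>x. (x (s j), ?A v x)) (?g j)"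
      using dec by (intro unif_cond_entropy_cong) auto
    also have "\<dots> = unif_cond_entropy \<Omega> (\<lambda>x. x (s j)) (?g j) + unif_cond_entropy \<Omega> (?A v) (\<lambda>x. (x (s j), ?g j x))"
      by (rule unif_cond_entropy_chain[OF finite_\<Omega>(1)])
    also have "unif_cond_entropy \<Omega> (\<lambda>x. x (s j)) (?g j) = L"
      by (rule unif_cond_entropy_coordinate) (use fin sj in auto)
    also have "unif_cond_entropy \<Omega> (?A v) (\<lambda>x. (x (s j), ?g j x)) = unif_cond_entropy \<Omega> (?A v) (?g (Suc j))"
      by (intro unif_cond_entropy_cong) (auto simp: lessThan_Suc restrict_def fun_eq_iff)
    finally show ?thesis by (simp only:)
  qed simp
  have "residual s j = (\<Sum>v\<in>Pi\<^sub>E N Q. W (s j) v * (L + unif_cond_entropy \<Omega> (?A v) (?g (Suc j))))"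
    unfolding residual_def by (intro sum.cong refl eq[symmetric])
  also have "\<dots> = L + (\<Sum>v\<in>Pi\<^sub>E N Q. W (s j) v * unif_cond_entropy \<Omega> (?A v) (?g (Suc j)))"
    unfolding distrib_left sum.distrib sum_distrib_right[symmetric] using W_sum[OF sj(1)] by simp
  finally show ?thesis by simp
qed

text \<open>Each answer depends on its own query only, so its entropy given the known files is a function
  \<open>G\<close> of that query with values in \<open>[0, L]\<close>. Passing from the query law of \<open>s j\<close> to that of
  \<open>s (Suc j)\<close> costs at most \<open>L\<close> times their total variation distance, which is 1 minus the
  overlap.\<close>

lemma residual_step:
  assumes s: "s ` {..<Suc (Suc j)} \<subseteq> I" "inj_on s {..<Suc (Suc j)}"
  shows "residual s j \<ge> residual s (Suc j) / card N + L * (overlap (s j) (s (Suc j)) / card N)"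
proof -
  define g where "g x = restrict x (s ` {..<Suc j})" for x :: "'m \<Rightarrow> 'x"
  define G where "G l q = unif_cond_entropy \<Omega> (a l q) g" for l q
  let ?A = "\<lambda>v x. \<lambda>l\<in>N. a l (v l) x"
  have n: "real (card N) > 0" using fin by (simp add: card_gt_0_iff)
  have sI: "s j \<in> I" "s (Suc j) \<in> I" using s(1) by auto
  have G: "0 \<le> G l q" "G l q \<le> L" if "l \<in> N" "q \<in> Q l" for l q
  proof -
    show "0 \<le> G l q" unfolding G_def by (intro unif_cond_entropy_nonneg finite_\<Omega>)
    have "G l q \<le> log 2 (card (a l q ` \<Omega>))"
      unfolding G_def using finite_\<Omega> by (intro unif_cond_entropy_le_log_card) auto
    also have "\<dots> \<le> L"
    proof -
      have "0 < card (a l q ` \<Omega>)" using finite_\<Omega> by (auto simp: card_gt_0_iff)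
      then show ?thesis using card_answers[OF that] by simp
    qed
    finally show "G l q \<le> L" .
  qed
  \<comment> \<open>Upper estimate by subadditivity, under the query law of
    \<open>s (Suc j)\<close>.\<close>
  have "residual s (Suc j) \<le> (\<Sum>v\<in>Pi\<^sub>E N Q. W (s (Suc j)) v * (\<Sum>l\<in>N. G l (v l)))"
    unfolding residual_def G_def g_def[abs_def]
    by (intro sum_mono mult_left_mono answers_entropy_le W_nonneg)
  also have "\<dots> = (\<Sum>l\<in>N. \<Sum>q\<in>Q l. marg l (s (Suc j)) q * G l q)"
    by (simp add: sum_distrib_left sum.swap[of _ N] sum_W_marg cong: sum.cong)
  finally have up: "residual s (Suc j) \<le> (\<Sum>l\<in>N. \<Sum>q\<in>Q l. marg l (s (Suc j)) q * G l q)" .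
  \<comment> \<open>Lower estimate under the query law of \<open>s j\<close>: all answers together
    have at least the entropy of each one, and summing over the servers costs the factor
    \<open>card N\<close>.\<close>
  have "(\<Sum>l\<in>N. \<Sum>q\<in>Q l. marg l (s j) q * G l q) =
    (\<Sum>v\<in>Pi\<^sub>E N Q. W (s j) v * (\<Sum>l\<in>N. G l (v l)))"
    by (simp add: sum_distrib_left sum.swap[of _ N] sum_W_marg cong: sum.cong)
  also have "\<dots> \<le> (\<Sum>v\<in>Pi\<^sub>E N Q. W (s j) v * (\<Sum>l\<in>N. unif_cond_entropy \<Omega> (?A v) g))"
    unfolding G_def
  proof (intro sum_mono mult_left_mono W_nonneg)
    fix v l assume "l \<in> N"
    then show "unif_cond_entropy \<Omega> (a l (v l)) g \<le> unif_cond_entropy \<Omega> (?A v) g"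
      by (rule unif_cond_entropy_tuple_ge[OF finite_\<Omega>(1), of l N "\<lambda>l. a l (v l)"])
  qed
  also have "\<dots> = card N * (\<Sum>v\<in>Pi\<^sub>E N Q. W (s j) v * unif_cond_entropy \<Omega> (?A v) g)"
    by (simp add: sum_distrib_left algebra_simps)
  also have "\<dots> \<le> card N * (residual s j - L)"
  proof -
    have "s ` {..<Suc j} \<subseteq> I" "inj_on s {..<Suc j}"
      using s by (auto intro: inj_on_subset)
    from residual_ge[OF this] show ?thesis
      unfolding g_def[abs_def] by (intro mult_left_mono) auto
  qed
  finally have low: "(\<Sum>l\<in>N. \<Sum>q\<in>Q l. marg l (s j) q * G l q) \<le> card N * (residual s j - L)" .
  \<comment> \<open>The common mass \<open>min p p'\<close> is charged to \<open>p\<close>; the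
    excess of \<open>p'\<close> is charged at the maximal value \<open>L\<close>.\<close>
  have "p' * y \<le> p * y + L * (p' - min p p')" if "0 \<le> y" "y \<le> L" for p p' y
  proof -
    have "(p' - min p p') * y \<le> (p' - min p p') * L" using that by (intro mult_left_mono) auto
    moreover have "min p p' * y \<le> p * y" using that by (intro mult_right_mono) auto
    ultimately show ?thesis by (simp add: algebra_simps)
  qed
  then have "(\<Sum>l\<in>N. \<Sum>q\<in>Q l. marg l (s (Suc j)) q * G l q) \<le> (\<Sum>l\<in>N. \<Sum>q\<in>Q l.
    marg l (s j) q * G l q + L * (marg l (s (Suc j)) q - min (marg l (s j) q) (marg l (s (Suc j)) q)))"
    using G by (intro sum_mono) auto
  also have "\<dots> = (\<Sum>l\<in>N. \<Sum>q\<in>Q l. marg l (s j) q * G l q) +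
      L * (card N - overlap (s j) (s (Suc j)))"
    by (simp add: overlap_def sum.distrib sum_subtractf sum_distrib_left[symmetric] marg_sum sI)
  finally have "residual s (Suc j) \<le> card N * residual s j - L * overlap (s j) (s (Suc j))"
    using up low by (simp add: algebra_simps)
  then show ?thesis using n by (simp add: field_simps)
qed

text \<open>Unrolls \<open>residual_step\<close> over \<open>d\<close> transitions. At the end
  \<open>residual_ge\<close> contributes \<open>L\<close> for the last file and its remaining
  entropy is dropped.\<close>

lemma residual_lower_bound:
  assumes "s ` {..<Suc (j + d)} \<subseteq> I" "inj_on s {..<Suc (j + d)}"
  shows "residual s j \<ge> L * (1 / card N ^ d +
    (\<Sum>i<d. 1 / card N ^ i * (overlap (s (j + i)) (s (Suc (j + i))) / card N)))"
  using assms
proof (induction d arbitrary: j)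
  case 0
  have "0 \<le> (\<Sum>v\<in>Pi\<^sub>E N Q. W (s j) v *
     unif_cond_entropy \<Omega> (\<lambda>x. \<lambda>l\<in>N. a l (v l) x) (\<lambda>x. restrict x (s ` {..<Suc j})))"
    by (intro sum_nonneg mult_nonneg_nonneg W_nonneg unif_cond_entropy_nonneg finite_\<Omega>)
  then show ?case using residual_ge[of s j] 0 by simp
next
  case (Suc d)
  let ?o = "\<lambda>i. overlap (s (j + i)) (s (Suc (j + i))) / card N"
  have "L * (1 / card N ^ Suc d + (\<Sum>i<Suc d. 1 / card N ^ i * ?o i)) =
    L * (1 / card N ^ d + (\<Sum>i<d. 1 / card N ^ i * ?o (Suc i))) / card N + L * ?o 0"
  proof -
    have "(\<Sum>i<Suc d. 1 / card N ^ i * ?o i) = ?o 0 + (\<Sum>i<d. 1 / card N ^ i * ?o (Suc i)) / card N"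
      by (subst sum.lessThan_Suc_shift) (simp add: sum_divide_distrib algebra_simps)
    then show ?thesis by (simp add: algebra_simps add_divide_distrib)
  qed
  also have "\<dots> \<le> residual s (Suc j) / card N + L * ?o 0"
    using Suc.IH[of "Suc j"] Suc.prems by (intro add_right_mono divide_right_mono) auto
  also have "\<dots> \<le> residual s j"
  proof -
    have "{..<Suc (Suc j)} \<subseteq> {..<Suc (j + Suc d)}" by auto
    then have "s ` {..<Suc (Suc j)} \<subseteq> I" "inj_on s {..<Suc (Suc j)}"
      using Suc.prems by (auto intro: inj_on_subset)
    from residual_step[OF this] show ?thesis by simp
  qed
  finally show ?case .
qed

text \<open>At position 0 no file is known yet, so subadditivity and the number of values of each
  answer bound the entropy.\<close>

lemma residual_0_le_cost:
  assumes "\<And>l q. l \<in> N \<Longrightarrow> q \<in> Q l \<Longrightarrow> log 2 (card (a l q ` \<Omega>)) \<le> c l q"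
  shows "residual s 0 \<le> (\<Sum>l\<in>N. \<Sum>q\<in>Q l. marg l (s 0) q * c l q)"
proof -
  have "residual s 0 \<le> (\<Sum>v\<in>Pi\<^sub>E N Q. W (s 0) v * (\<Sum>l\<in>N. c l (v l)))"
    unfolding residual_def
  proof (intro sum_mono mult_left_mono W_nonneg order.trans[OF answers_entropy_le])
    fix v l assume "v \<in> Pi\<^sub>E N Q" "l \<in> N"
    then have "log 2 (card (a l (v l) ` \<Omega>)) \<le> c l (v l)" using assms by auto
    moreover have "unif_cond_entropy \<Omega> (a l (v l)) (\<lambda>x. restrict x (s ` {..<0})) \<le> log 2 (card (a l (v l) ` \<Omega>))"
      using finite_\<Omega> by (intro unif_cond_entropy_le_log_card) auto
    ultimately show "unif_cond_entropy \<Omega> (a l (v l)) (\<lambda>x. restrict x (s ` {..<0})) \<le> c l (v l)" by simp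
  qed
  also have "\<dots> = (\<Sum>l\<in>N. \<Sum>q\<in>Q l. marg l (s 0) q * c l q)"
    by (simp add: sum_distrib_left sum.swap[of _ N] sum_W_marg cong: sum.cong)
  finally show ?thesis .
qed

text \<open>The injectivity hypothesis makes \<sigma> a single cycle, so every \<open>m\<close>
  starts an order of all files. Since the powers of \<sigma> permute \<open>I\<close>, summing over
  the starting points turns the overlaps at each depth into the same sum over adjacent pairs, which
  \<open>overlap_fano\<close> bounds.\<close>

lemma cost_lower_bound:
  fixes \<rho> :: real
  assumes \<sigma>: "bij_betw \<sigma> I I" "\<And>m. m \<in> I \<Longrightarrow> inj_on (\<lambda>j. (\<sigma> ^^ j) m) {..<card I}"
    and c: "\<And>l q. l \<in> N \<Longrightarrow> q \<in> Q l \<Longrightarrow> log 2 (card (a l q ` \<Omega>)) \<le> c l q"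
    and leak: "(\<Sum>l\<in>N. \<Sum>m\<in>I. \<Sum>q\<in>Q l.
        marg l m q * log 2 (marg l m q / ((\<Sum>m'\<in>I. marg l m' q) / card I))) \<le>
        \<rho> * (card N * card I)"
    and \<rho>: "0 \<le> \<rho>" "\<rho> \<le> 1"
  shows "L * (1 / card N ^ (card I - 1) +
      2 * (\<Sum>i<card I - 1. 1 / card N ^ i * binary_entropy_inv (1 - \<rho>))) * card I \<le>
    (\<Sum>m\<in>I. \<Sum>l\<in>N. \<Sum>q\<in>Q l. marg l m q * c l q)"
proof -
  \<comment> \<open>The number of transitions in an order of all files.\<close>
  define k where "k = card I - 1"
  have k: "card I = Suc k" using fin by (simp add: k_def card_gt_0_iff)
  have n: "real (card N) > 0" using fin by (simp add: card_gt_0_iff)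
  have \<sigma>i: "bij_betw (\<sigma> ^^ i) I I" for i by (rule bij_betw_funpow[OF \<sigma>(1)])
  define h where "h = binary_entropy_inv (1 - \<rho>)"
  have ov: "2 * h * (card N * card I) \<le> (\<Sum>m\<in>I. overlap m (\<sigma> m))"
  proof -
    have "2 * h * (card N * card I) \<le>
      (\<Sum>l\<in>N. \<Sum>m\<in>I. \<Sum>q\<in>Q l. min (marg l m q) (marg l (\<sigma> m) q))"
      unfolding h_def using fin \<sigma>(1) marg_nonneg marg_sum leak \<rho> by (intro overlap_fano) auto
    also have "\<dots> = (\<Sum>m\<in>I. overlap m (\<sigma> m))"
      unfolding overlap_def by (rule sum.swap)
    finally show ?thesis .
  qed
  have shift: "(\<Sum>m\<in>I. overlap ((\<sigma> ^^ i) m) ((\<sigma> ^^ Suc i) m)) = (\<Sum>m\<in>I. overlap m (\<sigma> m))" for i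
    using sum.reindex_bij_betw[OF \<sigma>i, of "\<lambda>m. overlap m (\<sigma> m)" i] by simp
  have avg: "L * (card I * c + (\<Sum>i<k. \<Sum>m\<in>I. f i m)) = (\<Sum>m\<in>I. L * (c + (\<Sum>i<k. f i m)))"
    for c :: real and f :: "nat \<Rightarrow> 'm \<Rightarrow> real"
    by (simp only: sum_distrib_left[symmetric] sum.distrib sum.swap[of _ "{..<k}" I] sum_constant)
  have "L * (1 / card N ^ k + 2 * (\<Sum>i<k. 1 / card N ^ i * h)) * card I =
    L * (card I / card N ^ k + (\<Sum>i<k. 1 / card N ^ i * (2 * h * (card N * card I) / card N)))"
    using n by (simp add: sum_distrib_right sum_distrib_left algebra_simps)
  also have "\<dots> \<le> L * (card I / card N ^ k + (\<Sum>i<k. 1 / card N ^ i * ((\<Sum>m\<in>I. overlap m (\<sigma> m)) / card N)))"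
    by (intro mult_left_mono add_left_mono sum_mono divide_right_mono ov L_nonneg) auto
  also have "\<dots> = L * (card I / card N ^ k + (\<Sum>i<k. \<Sum>m\<in>I. 1 / card N ^ i *
      (overlap ((\<sigma> ^^ i) m) ((\<sigma> ^^ Suc i) m) / card N)))"
    unfolding sum_distrib_left[symmetric] sum_divide_distrib[symmetric] shift ..
  also have "\<dots> = (\<Sum>m\<in>I. L * (1 / card N ^ k + (\<Sum>i<k. 1 / card N ^ i *
      (overlap ((\<sigma> ^^ i) m) ((\<sigma> ^^ Suc i) m) / card N))))"
    using avg[of "1 / card N ^ k"
        "\<lambda>i m. 1 / card N ^ i * (overlap ((\<sigma> ^^ i) m) ((\<sigma> ^^ Suc i) m) / card N)"]
    by (simp only: times_divide_eq_right mult_1_right)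
  also have "\<dots> \<le> (\<Sum>m\<in>I. \<Sum>l\<in>N. \<Sum>q\<in>Q l. marg l m q * c l q)"
  proof (rule sum_mono)
    fix m assume m: "m \<in> I"
    let ?s = "\<lambda>j. (\<sigma> ^^ j) m"
    have "?s ` {..<Suc (0 + k)} \<subseteq> I"
      using bij_betw_apply[OF \<sigma>i m] by auto
    from residual_lower_bound[OF this] \<sigma>(2)[OF m] residual_0_le_cost[of c ?s, OF c]
    show "L * (1 / card N ^ k + (\<Sum>i<k. 1 / card N ^ i *
      (overlap (?s i) (?s (Suc i)) / card N))) \<le> (\<Sum>l\<in>N. \<Sum>q\<in>Q l. marg l m q * c l q)"
      by (simp add: k)
  qed
  finally show ?thesis by (simp only: h_def k_def)
qed

end

section \<open>The probability space of a scheme\<close>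

declare One_nat_def [simp del]

locale finite_ir_scheme =
  fixes K n :: nat and sc :: "('s, 'q, 'x, 'a) ir_scheme"
  assumes K: "K \<ge> 1" and n: "n \<ge> 1"
    and scheme: "is_ir_scheme K n sc"
    and finite_query: "\<And>l. l \<in> {1..n} \<Longrightarrow> finite (query_alphabet sc l)"
begin

abbreviation "I \<equiv> {1..K}"
abbreviation "N \<equiv> {1..n}"
abbreviation "Q \<equiv> query_alphabet sc"
abbreviation "F \<equiv> file_space sc"
abbreviation "\<Omega> \<equiv> I \<rightarrow>\<^sub>E F"
abbreviation "St \<equiv> strategy sc"
abbreviation "P \<equiv> ir_space K sc"
abbreviation "files \<equiv> \<Pi>\<^sub>M i\<in>I. uniform_count_measure F"

definition queries :: "nat \<Rightarrow> 's \<Rightarrow> nat \<Rightarrow> 'q" where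
  "queries m s = (\<lambda>l\<in>N. query sc l m s)"

text \<open>The strategy space is arbitrary, but finite query alphabets make the law of the query
  vector discrete, so point masses describe it.\<close>

definition W :: "nat \<Rightarrow> (nat \<Rightarrow> 'q) \<Rightarrow> real" where
  "W m v = measure St {s \<in> space St. queries m s = v}"

lemma card_F: "card F = card (file_alphabet sc) ^ file_length sc"
  and finite_F: "finite F" and card_F_ge_2: "card F \<ge> 2"
proof -
  have X: "finite (file_alphabet sc)" "card (file_alphabet sc) \<ge> 2" "file_length sc \<ge> 1"
    using scheme by (auto simp: is_ir_scheme_def)
  show c: "card F = card (file_alphabet sc) ^ file_length sc"
    using X by (simp add: file_space_def words_def card_lists_length_eq)
  show "finite F"
    using X by (simp add: file_space_def words_def finite_lists_length_eq)
  have "2 ^ 1 \<le> card (file_alphabet sc) ^ file_length sc"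
    using X by (meson order.trans power_increasing power_mono one_le_numeral zero_le)
  then show "card F \<ge> 2" using c by simp
qed

lemma F_nonempty: "F \<noteq> {}"
  using card_F_ge_2 by auto

lemma finite_\<Omega>: "finite \<Omega>"
  using finite_F by (auto intro: finite_PiE)

lemma \<Omega>_nonempty: "\<Omega> \<noteq> {}"
  using F_nonempty by (auto simp: PiE_eq_empty_iff)

lemma finite_V: "finite (Pi\<^sub>E N Q)"
  using finite_query by (auto intro: finite_PiE)

sublocale St: prob_space St
  using scheme by (simp add: is_ir_scheme_def)

sublocale idx: prob_space "uniform_count_measure I"
  using K by (intro prob_space_uniform_count_measure) auto

lemma prob_space_F: "prob_space (uniform_count_measure F)"
  using finite_F F_nonempty by (intro prob_space_uniform_count_measure)

sublocale files: prob_space files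
  using prob_space_F by (intro prob_space_PiM)

sublocale StF: pair_prob_space St files ..

sublocale P3: pair_prob_space "uniform_count_measure I" "St \<Otimes>\<^sub>M files" ..

sublocale P: information_space P 2
proof -
  interpret prob_space P unfolding ir_space_def by (rule P3.prob_space_axioms)
  show "information_space P 2" by unfold_locales simp
qed

lemma space_P: "space P = I \<times> space St \<times> \<Omega>"
  by (simp add: ir_space_def space_pair_measure space_PiM space_uniform_count_measure)

text \<open>Independence of index, strategy and files, with \<open>1 / K\<close> from the uniform
  index. Finite unions of such rectangles make up the events below.\<close>

lemma measure_rectangle:
  assumes "m \<in> I" "B \<in> sets St" "C \<in> sets files"
  shows "{m} \<times> B \<times> C \<in> sets P" "measure P ({m} \<times> B \<times> C) = measure St B * measure files C / K"
proof -
  have m: "{m} \<in> sets (uniform_count_measure I)" using assms by (simp add: sets_uniform_count_measure)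
  then show "{m} \<times> B \<times> C \<in> sets P"
    unfolding ir_space_def using assms by (intro pair_measureI) auto
  have "measure P ({m} \<times> B \<times> C) =
    measure (uniform_count_measure I) {m} * (measure St B * measure files C)"
    unfolding ir_space_def measure_def using assms m
    by (simp add: enn2real_mult
        sigma_finite_measure.emeasure_pair_measure_Times[OF prob_space_imp_sigma_finite[OF files.prob_space_axioms]]
        sigma_finite_measure.emeasure_pair_measure_Times[OF prob_space_imp_sigma_finite[OF StF.prob_space_axioms]])
  then show "measure P ({m} \<times> B \<times> C) = measure St B * measure files C / K"
    using assms by (simp add: measure_uniform_count_measure)
qed

text \<open>Positivity turns decodability almost surely into decodability for every list of
  files.\<close>

lemma singleton_files:
  assumes "x \<in> \<Omega>"
  shows "{x} \<in> sets files" "measure files {x} > 0"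
proof -
  interpret product_prob_space "\<lambda>_. uniform_count_measure F" I
    by (rule product_prob_spaceI[OF prob_space_F])
  interpret fp: finite_product_prob_space "\<lambda>_. uniform_count_measure F" I
    by unfold_locales simp
  have eq: "{x} = (\<Pi>\<^sub>E i\<in>I. {x i})"
    using assms by (intro PiE_singleton[symmetric]) (simp add: PiE_iff)
  have x: "x i \<in> F" if "i \<in> I" for i using assms that by auto
  then have s: "{x i} \<in> sets (uniform_count_measure F)" if "i \<in> I" for i
    using that by (simp add: sets_uniform_count_measure)
  show "{x} \<in> sets files"
    unfolding eq using s by (intro sets_PiM_I_finite) auto
  have "measure files {x} = (\<Prod>i\<in>I. measure (uniform_count_measure F) {x i})"
    unfolding eq using s by (rule fp.prob_times)
  also have "\<dots> > 0"
    using x finite_F F_nonempty by (intro prod_pos) (auto simp: measure_uniform_count_measure card_gt_0_iff)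
  finally show "measure files {x} > 0" .
qed

section \<open>The law of the query vector and decodability\<close>

lemma query_measurable:
  "l \<in> N \<Longrightarrow> m \<in> I \<Longrightarrow> query sc l m \<in> St \<rightarrow>\<^sub>M count_space (Q l)"
  using scheme by (simp add: is_ir_scheme_def)

lemma query_in: "l \<in> N \<Longrightarrow> m \<in> I \<Longrightarrow> s \<in> space St \<Longrightarrow> query sc l m s \<in> Q l"
  using measurable_space[OF query_measurable] by auto

lemma queries_in: "m \<in> I \<Longrightarrow> s \<in> space St \<Longrightarrow> queries m s \<in> Pi\<^sub>E N Q"
  using query_in by (auto simp: queries_def)

lemma query_sets: "l \<in> N \<Longrightarrow> m \<in> I \<Longrightarrow> {s \<in> space St. query sc l m s = q} \<in> sets St"
  \<comment> \<open>The intersection with \<open>Q l\<close> covers a \<open>q\<close> outside the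
    alphabet, whose event is empty.\<close>
  using measurable_sets[OF query_measurable, of l m "{q} \<inter> Q l"] query_in[of l m]
  by (auto simp: vimage_def Int_def conj_commute cong: conj_cong rev_conj_cong)

lemma queries_sets:
  assumes "m \<in> I"
  shows "{s \<in> space St. queries m s = v} \<in> sets St"
proof (cases "v \<in> extensional N")
  case True
  then have "{s \<in> space St. queries m s = v} = {s \<in> space St. \<forall>l\<in>N. query sc l m s = v l}"
    by (auto simp: queries_def restrict_def extensional_def fun_eq_iff)
  also have "\<dots> \<in> sets St"
    using query_sets assms by (intro sets.sets_Collect_finite_All) auto
  finally show ?thesis .
next
  case False
  then have "{s \<in> space St. queries m s = v} = {}"
    by (auto simp: queries_def)
  then show ?thesis by (simp only: sets.empty_sets)
qed

lemma sum_W: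
  assumes "m \<in> I" "C \<subseteq> Pi\<^sub>E N Q"
  shows "(\<Sum>v\<in>C. W m v) = measure St {s \<in> space St. queries m s \<in> C}"
proof -
  have "{s \<in> space St. queries m s \<in> C} = (\<Union>v\<in>C. {s \<in> space St. queries m s = v})" by auto
  moreover have "measure St (\<Union>v\<in>C. {s \<in> space St. queries m s = v}) =
      (\<Sum>v\<in>C. measure St {s \<in> space St. queries m s = v})"
    using queries_sets[OF assms(1)] finite_subset[OF assms(2) finite_V]
    by (intro St.finite_measure_finite_Union) (auto simp: disjoint_family_on_def)
  ultimately show ?thesis by (simp add: W_def)
qed

text \<open>A variable that uses the strategy only through the query vector takes finitely many
  values on finite unions of rectangles. This settles measurability for an arbitrary strategy
  measure.\<close>

lemma simple_function_P:
  assumes "\<And>m s x. m \<in> I \<Longrightarrow> s \<in> space St \<Longrightarrow> x \<in> \<Omega> \<Longrightarrow> f (m, s, x) = g m (queries m s) x"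
  shows "simple_function P f"
  unfolding simple_function_def
proof (intro conjI ballI)
  have "f ` space P \<subseteq> (\<lambda>(m, v, x). g m v x) ` (I \<times> Pi\<^sub>E N Q \<times> \<Omega>)"
  proof
    fix y assume "y \<in> f ` space P"
    then obtain m s x where "m \<in> I" "s \<in> space St" "x \<in> \<Omega>" "y = f (m, s, x)"
      by (auto simp: space_P)
    then have "(m, queries m s, x) \<in> I \<times> Pi\<^sub>E N Q \<times> \<Omega>"
        "y = (\<lambda>(m, v, x). g m v x) (m, queries m s, x)"
      using assms queries_in by auto
    then show "y \<in> (\<lambda>(m, v, x). g m v x) ` (I \<times> Pi\<^sub>E N Q \<times> \<Omega>)" by (rule rev_image_eqI)
  qed
  then show "finite (f ` space P)"
    by (rule finite_subset)
      (intro finite_imageI finite_cartesian_product finite_V finite_\<Omega> finite_atLeastAtMost)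
  fix y
  have "f -` {y} \<inter> space P = (\<Union>(m, v, x) \<in> {(m, v, x) \<in> I \<times> Pi\<^sub>E N Q \<times> \<Omega>. g m v x = y}.
      {m} \<times> {s \<in> space St. queries m s = v} \<times> {x})"
    using assms queries_in by (auto simp: space_P)
  also have "\<dots> \<in> sets P"
  proof (intro sets.finite_UN)
    have "finite (I \<times> Pi\<^sub>E N Q \<times> \<Omega>)"
      by (intro finite_cartesian_product finite_V finite_\<Omega> finite_atLeastAtMost)
    then show "finite {(m, v, x) \<in> I \<times> Pi\<^sub>E N Q \<times> \<Omega>. g m v x = y}"
      by (rule rev_finite_subset) auto
  qed (auto intro!: measure_rectangle(1) queries_sets singleton_files(1))
  finally show "f -` {y} \<inter> space P \<in> sets P" .
qed

text \<open>Zero conditional entropy forces each attained pair of file and observation to be as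
  likely as the observation alone. Two lists with the same answers but different files
  \<open>m\<close> would give two disjoint events of positive probability inside one
  observation.\<close>

lemma decode:
  assumes m: "m \<in> I" and v: "v \<in> Pi\<^sub>E N Q" "W m v > 0" and x: "x \<in> \<Omega>" "y \<in> \<Omega>"
    and eq: "\<And>l. l \<in> N \<Longrightarrow> answer sc l (v l) x = answer sc l (v l) y"
  shows "x m = y m"
proof (rule ccontr)
  assume neq: "x m \<noteq> y m"
  let ?Y = "\<lambda>\<omega>. (\<lambda>l\<in>N. answer_rv sc l \<omega>, \<lambda>l\<in>N. query_rv sc l \<omega>, index_rv \<omega>)"
  let ?U = requested_file_rv
  define Py where "Py y = measure P (?Y -` {y} \<inter> space P)" for y
  define Pxy where "Pxy z = measure P ((\<lambda>\<omega>. (?U \<omega>, ?Y \<omega>)) -` {z} \<inter> space P)" for z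
  have sY: "simple_function P ?Y"
    by (rule simple_function_P[where g = "\<lambda>m v x. (\<lambda>l\<in>N. answer sc l (v l) x, v, m)"])
      (auto simp: answer_rv_def query_rv_def index_rv_def queries_def restrict_def)
  have sU: "simple_function P ?U"
    by (rule simple_function_P[where g = "\<lambda>m v x. x m"]) (simp add: requested_file_rv_def)
  have sUY: "simple_function P (\<lambda>\<omega>. (?U \<omega>, ?Y \<omega>))"
    using sU sY by (rule simple_function_Pair)
  have Y: "simple_distributed P ?Y Py"
    using sY by (rule P.simple_distributedI) (auto simp: Py_def)
  have UY: "simple_distributed P (\<lambda>\<omega>. (?U \<omega>, ?Y \<omega>)) Pxy"
    using sUY by (rule P.simple_distributedI) (auto simp: Pxy_def)
  have setsY: "?Y -` {z} \<inter> space P \<in> sets P" for z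
    using sY by (rule simple_functionD(2))
  have setsUY: "(\<lambda>\<omega>. (?U \<omega>, ?Y \<omega>)) -` {z} \<inter> space P \<in> sets P" for z
    using sUY by (rule simple_functionD(2))
  have Pxy_le: "Pxy (u, z) \<le> Py z" for u z
    unfolding Py_def Pxy_def using setsY by (intro P.finite_measure_mono) auto
  \<comment> \<open>The terms of the conditional entropy. They are nonnegative because
    \<open>Pxy \<le> Py\<close>, so each of them vanishes.\<close>
  define h where "h = (\<lambda>(u, z). - (Pxy (u, z) * log 2 (Pxy (u, z) / Py z)))"
  have "0 = cond_entropy P ?U ?Y"
    using scheme by (simp add: is_ir_scheme_def)
  also have "\<dots> = (\<Sum>z\<in>(\<lambda>\<omega>. (?U \<omega>, ?Y \<omega>)) ` space P. h z)"
    unfolding cond_entropy_def P.conditional_entropy_eq[OF Y UY] h_def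
    by (simp add: split_def sum_negf)
  finally have "(\<Sum>z\<in>(\<lambda>\<omega>. (?U \<omega>, ?Y \<omega>)) ` space P. h z) = 0" by simp
  moreover have h_nonneg: "0 \<le> h z" for z
  proof -
    obtain u z' where z: "z = (u, z')" by (cases z)
    show ?thesis
    proof (cases "Pxy z = 0")
      case False
      then have "0 < Pxy z" by (simp add: Pxy_def less_le)
      then have "log 2 (Pxy z / Py z') \<le> 0"
        using Pxy_le[of u z'] by (simp add: z)
      then show ?thesis
        using \<open>0 < Pxy z\<close> by (simp add: h_def z mult_nonneg_nonpos)
    qed (simp add: h_def z)
  qed
  ultimately have h0: "h z = 0" if "z \<in> (\<lambda>\<omega>. (?U \<omega>, ?Y \<omega>)) ` space P" for z
    using that h_nonneg sum_nonneg_eq_0_iff[OF simple_functionD(1)[OF sUY], of h] by blast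
  let ?S = "{s \<in> space St. queries m s = v}"
  have S: "?S \<in> sets St" by (rule queries_sets[OF m])
  define z where "z = (\<lambda>l\<in>N. answer sc l (v l) x, v, m)"
  have Yz: "?Y (m, s, w) = z" if "s \<in> ?S" "w \<in> {x, y}" for s w
  proof -
    have qv: "queries m s = v" using that by simp
    have "query sc l m s = v l" if "l \<in> N" for l
      using fun_cong[OF qv, of l] that by (simp add: queries_def)
    then have "(\<lambda>l\<in>N. answer sc l (query sc l m s) w) = (\<lambda>l\<in>N. answer sc l (v l) x)"
      using that(2) eq by (intro restrict_ext) auto
    with qv show ?thesis
      by (simp add: z_def answer_rv_def query_rv_def index_rv_def queries_def)
  qed
  \<comment> \<open>This rectangle of positive measure witnesses that the pair has positive
    probability, for both lists.\<close>
  have rect: "{m} \<times> ?S \<times> {w} \<subseteq> (\<lambda>\<omega>. (?U \<omega>, ?Y \<omega>)) -` {(w m, z)} \<inter> space P"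
    if "w \<in> {x, y}" for w
  proof -
    have "w \<in> \<Omega>" using that x by auto
    then show ?thesis using Yz[OF _ that] m by (auto simp: requested_file_rv_def space_P)
  qed
  have pos: "Pxy (w m, z) > 0" if "w \<in> {x, y}" for w
  proof -
    have w: "w \<in> \<Omega>" using that x by auto
    have "0 < measure St ?S * measure files {w} / K"
      using v(2) singleton_files(2)[OF w] K by (simp add: W_def)
    also have "\<dots> = measure P ({m} \<times> ?S \<times> {w})"
      using measure_rectangle(2)[OF m S singleton_files(1)[OF w]] by simp
    also have "\<dots> \<le> Pxy (w m, z)"
      unfolding Pxy_def by (rule P.finite_measure_mono[OF rect[OF that] setsUY])
    finally show ?thesis .
  qed
  obtain s where s: "s \<in> ?S"
    using v(2) by (auto simp: W_def) (metis (mono_tags, lifting) empty_Collect_eq less_irrefl measure_empty)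
  have "(x m, z) \<in> (\<lambda>\<omega>. (?U \<omega>, ?Y \<omega>)) ` space P"
    using rect[of x] s by (force simp: image_iff)
  then have "h (x m, z) = 0" by (rule h0)
  then have "log 2 (Pxy (x m, z) / Py z) = 0"
    using pos[of x] by (simp add: h_def)
  moreover have "0 < Pxy (x m, z) / Py z"
    using pos[of x] Pxy_le[of "x m" z] by simp
  ultimately have "Pxy (x m, z) / Py z = 1"
    by (simp add: log_def)
  then have "Pxy (x m, z) = Py z"
    using pos[of x] Pxy_le[of "x m" z] by (simp add: divide_eq_1_iff)
  moreover have "Pxy (x m, z) + Pxy (y m, z) \<le> Py z"
  proof -
    have "Pxy (x m, z) + Pxy (y m, z) =
      measure P (((\<lambda>\<omega>. (?U \<omega>, ?Y \<omega>)) -` {(x m, z)} \<inter> space P) \<union>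
        ((\<lambda>\<omega>. (?U \<omega>, ?Y \<omega>)) -` {(y m, z)} \<inter> space P))"
      unfolding Pxy_def using neq setsUY by (intro P.finite_measure_Union[symmetric]) auto
    also have "\<dots> \<le> Py z"
      unfolding Py_def using setsY by (intro P.finite_measure_mono) auto
    finally show ?thesis .
  qed
  ultimately show False using pos[of y] by simp
qed

lemma measure_query:
  assumes "l \<in> N" "m \<in> I"
  shows "measure P ({m} \<times> {s \<in> space St. query sc l m s = q} \<times> \<Omega>) =
    measure St {s \<in> space St. query sc l m s = q} / K"
proof -
  have "\<Omega> = space files" by (simp add: space_PiM space_uniform_count_measure)
  then show ?thesis
    using measure_rectangle(2)[OF assms(2) query_sets[OF assms], of "space files" q]
    by (simp add: files.prob_space)
qed

section \<open>Mutual information and download cost\<close>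

lemma answer_in:
  "l \<in> N \<Longrightarrow> q \<in> Q l \<Longrightarrow> x \<in> \<Omega> \<Longrightarrow>
    answer sc l q x \<in> words (answer_alphabet sc) (answer_length sc l q)"
  using scheme by (simp add: is_ir_scheme_def)

text \<open>For positive length this is admissibility. At length 0 the only answer is the empty
  word, which \<open>answer_values\<close> omits, and one value is within the bound.\<close>

lemma card_answers:
  assumes adm: "admissible K n sc" and l: "l \<in> N" and q: "q \<in> Q l"
  shows "card (answer sc l q ` \<Omega>) \<le> card F"
proof (cases "answer_length sc l q > 0")
  case True
  have "answer sc l q ` \<Omega> \<subseteq> answer_values K sc l"
    using True q by (auto simp: answer_values_def)
  moreover have "finite (answer_values K sc l)" "card (answer_values K sc l) \<le> card F"
    using adm l by (auto simp: admissible_def card_F)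
  ultimately show ?thesis by (meson card_mono order.trans)
next
  case False
  have "answer sc l q ` \<Omega> \<subseteq> {[]}"
    using answer_in[OF l q] False by (auto simp: words_def)
  then have "card (answer sc l q ` \<Omega>) \<le> card {[] :: 'a list}" by (intro card_mono) auto
  then show ?thesis using card_F_ge_2 by simp
qed

lemma finite_retrieval_scheme:
  assumes "admissible K n sc"
  shows "finite_retrieval F I N Q W (answer sc)"
proof
  show "(\<Sum>v\<in>Pi\<^sub>E N Q. W m v) = 1" if "m \<in> I" for m
  proof -
    have "{s \<in> space St. queries m s \<in> Pi\<^sub>E N Q} = space St" using queries_in[OF that] by auto
    then show ?thesis using sum_W[OF that order.refl] by (simp add: St.prob_space)
  qed
qed (use finite_F F_nonempty K n finite_query decode card_answers[OF assms] in \<open>auto simp: W_def\<close>)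

abbreviation pquery :: "nat \<Rightarrow> nat \<Rightarrow> 'q \<Rightarrow> real" where
  "pquery l m q \<equiv> measure St {s \<in> space St. query sc l m s = q}"

lemma marg_eq:
  assumes "admissible K n sc" "l \<in> N" "m \<in> I"
  shows "finite_retrieval.marg N Q W l m q = pquery l m q"
proof -
  interpret core: finite_retrieval F I N Q W "answer sc" by (rule finite_retrieval_scheme[OF assms(1)])
  have "core.marg l m q = measure St {s \<in> space St. queries m s \<in> {v. v \<in> Pi\<^sub>E N Q \<and> v l = q}}"
    unfolding core.marg_def using assms by (intro sum_W) auto
  also have "{s \<in> space St. queries m s \<in> {v. v \<in> Pi\<^sub>E N Q \<and> v l = q}} =
      {s \<in> space St. query sc l m s = q}"
    using queries_in[OF assms(3)] assms(2) by (auto simp: queries_def)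
  finally show ?thesis .
qed

lemma simple_function_index: "simple_function P index_rv"
  by (rule simple_function_P[where g = "\<lambda>m v x. m"]) (simp add: index_rv_def)

lemma simple_function_query: "l \<in> N \<Longrightarrow> simple_function P (query_rv sc l)"
  by (rule simple_function_P[where g = "\<lambda>m v x. v l"]) (simp add: query_rv_def queries_def)

lemma measure_index_query:
  assumes "l \<in> N" "m \<in> I"
  shows "measure P ((\<lambda>\<omega>. (index_rv \<omega>, query_rv sc l \<omega>)) -` {(m, q)} \<inter> space P) = pquery l m q / K"
proof -
  have "(\<lambda>\<omega>. (index_rv \<omega>, query_rv sc l \<omega>)) -` {(m, q)} \<inter> space P =
      {m} \<times> {s \<in> space St. query sc l m s = q} \<times> \<Omega>"
    using assms by (auto simp: space_P index_rv_def query_rv_def)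
  then show ?thesis using measure_query[OF assms] by simp
qed

lemma sets_index_query:
  "l \<in> N \<Longrightarrow> (\<lambda>\<omega>. (index_rv \<omega>, query_rv sc l \<omega>)) -` {z} \<inter> space P \<in> sets P"
  by (intro simple_functionD(2) simple_function_Pair simple_function_index simple_function_query)

lemma measure_index:
  assumes "m \<in> I"
  shows "measure P (index_rv -` {m} \<inter> space P) = 1 / K"
proof -
  have "index_rv -` {m} \<inter> space P = {m} \<times> space St \<times> space files"
    using assms by (auto simp: space_P index_rv_def space_PiM space_uniform_count_measure)
  then show ?thesis
    using measure_rectangle(2)[OF assms sets.top sets.top] by (simp add: St.prob_space files.prob_space)
qed

lemma measure_query_rv:
  assumes "l \<in> N"
  shows "measure P (query_rv sc l -` {q} \<inter> space P) = (\<Sum>m\<in>I. pquery l m q) / K"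
proof -
  have "query_rv sc l -` {q} \<inter> space P =
      (\<Union>m\<in>I. (\<lambda>\<omega>. (index_rv \<omega>, query_rv sc l \<omega>)) -` {(m, q)} \<inter> space P)"
    by (auto simp: space_P index_rv_def)
  also have "measure P \<dots> =
      (\<Sum>m\<in>I. measure P ((\<lambda>\<omega>. (index_rv \<omega>, query_rv sc l \<omega>)) -` {(m, q)} \<inter> space P))"
    using sets_index_query[OF assms]
    by (intro P.finite_measure_finite_Union) (auto simp: disjoint_family_on_def)
  also have "\<dots> = (\<Sum>m\<in>I. pquery l m q) / K"
    using measure_index_query[OF assms] by (simp add: sum_divide_distrib)
  finally show ?thesis .
qed

text \<open>The mean divergence of the query laws from their mixture, in the form that
  \<open>overlap_fano\<close> takes.\<close>

lemma mutual_info_eq: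
  assumes l: "l \<in> N"
  shows "mutual_info P index_rv (query_rv sc l) = (\<Sum>m\<in>I. \<Sum>q\<in>Q l.
    pquery l m q * log 2 (pquery l m q / ((\<Sum>m'\<in>I. pquery l m' q) / K))) / K"
proof -
  let ?XY = "\<lambda>\<omega>. (index_rv \<omega>, query_rv sc l \<omega>)"
  define Px where "Px m = measure P (index_rv -` {m} \<inter> space P)" for m
  define Py where "Py q = measure P (query_rv sc l -` {q} \<inter> space P)" for q
  define Pxy where "Pxy z = measure P (?XY -` {z} \<inter> space P)" for z
  have X: "simple_distributed P index_rv Px"
    using simple_function_index by (rule P.simple_distributedI) (auto simp: Px_def)
  have Y: "simple_distributed P (query_rv sc l) Py"
    using simple_function_query[OF l] by (rule P.simple_distributedI) (auto simp: Py_def)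
  have XY: "simple_distributed P ?XY Pxy"
    using simple_function_Pair[OF simple_function_index simple_function_query[OF l]]
    by (rule P.simple_distributedI) (auto simp: Pxy_def)
  have "mutual_info P index_rv (query_rv sc l) =
      (\<Sum>(m, q)\<in>?XY ` space P. Pxy (m, q) * log 2 (Pxy (m, q) / (Px m * Py q)))"
    unfolding mutual_info_def by (rule P.mutual_information_simple_distributed[OF X Y XY])
  \<comment> \<open>The pairs added here have probability 0.\<close>
  also have "\<dots> = (\<Sum>(m, q)\<in>I \<times> Q l. Pxy (m, q) * log 2 (Pxy (m, q) / (Px m * Py q)))"
  proof (rule sum.mono_neutral_left)
    show "finite (I \<times> Q l)" using finite_query[OF l] by simp
    show "?XY ` space P \<subseteq> I \<times> Q l"
      using query_in[OF l] by (auto simp: space_P index_rv_def query_rv_def)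
    have "Pxy z = 0" if "z \<notin> ?XY ` space P" for z
    proof -
      have "?XY -` {z} \<inter> space P = {}" using that by auto
      then show ?thesis by (simp only: Pxy_def measure_empty)
    qed
    then show "\<forall>i\<in>I \<times> Q l - ?XY ` space P.
        (case i of (m, q) \<Rightarrow> Pxy (m, q) * log 2 (Pxy (m, q) / (Px m * Py q))) = 0"
      by auto
  qed
  \<comment> \<open>The factor \<open>1 / K\<close> of the joint law cancels against
    \<open>Px m\<close> inside the logarithm and survives outside.\<close>
  also have "\<dots> = (\<Sum>(m, q)\<in>I \<times> Q l.
      pquery l m q * log 2 (pquery l m q / ((\<Sum>m'\<in>I. pquery l m' q) / K)) / K)"
    using K by (intro sum.cong refl)
      (auto simp: Px_def Py_def Pxy_def measure_index measure_query_rv[OF l] measure_index_query[OF l])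
  also have "\<dots> = (\<Sum>m\<in>I. \<Sum>q\<in>Q l.
    pquery l m q * log 2 (pquery l m q / ((\<Sum>m'\<in>I. pquery l m' q) / K))) / K"
    by (simp only: sum.cartesian_product[symmetric] sum_divide_distrib)
  finally show ?thesis .
qed

lemma expectation_query:
  fixes f :: "'q \<Rightarrow> real"
  assumes l: "l \<in> N"
  shows "(\<integral>\<omega>. f (query_rv sc l \<omega>) \<partial>P) = (\<Sum>m\<in>I. \<Sum>q\<in>Q l. pquery l m q * f q) / K" (is "?lhs = _")
proof -
  let ?R = "\<lambda>m q. {m} \<times> {s \<in> space St. query sc l m s = q} \<times> \<Omega>"
  have "\<Omega> = space files" by (simp add: space_PiM space_uniform_count_measure)
  then have R: "?R m q \<in> sets P" if "m \<in> I" for m q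
    using measure_rectangle(1)[OF that query_sets[OF l that] sets.top] by simp
  \<comment> \<open>The rectangles partition the space and the integrand is constant on each, so it
    is a finite combination of indicators.\<close>
  have "f (query_rv sc l \<omega>) = (\<Sum>m\<in>I. \<Sum>q\<in>Q l. f q * indicator (?R m q) \<omega>)"
    if \<omega>P: "\<omega> \<in> space P" for \<omega>
  proof -
    obtain m s x where \<omega>: "\<omega> = (m, s, x)" "m \<in> I" "s \<in> space St" "x \<in> \<Omega>"
      using \<omega>P unfolding space_P by blast
    have "(\<Sum>m'\<in>I. \<Sum>q\<in>Q l. f q * indicator (?R m' q) \<omega>) =
        (\<Sum>m'\<in>I. if m' = m then \<Sum>q\<in>Q l. if q = query sc l m s then f q else 0 else 0)"
      using \<omega> by (intro sum.cong refl) (auto simp: indicator_def intro!: sum.cong sum.neutral)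
    also have "\<dots> = f (query sc l m s)"
      using \<omega> finite_query[OF l] query_in[OF l] by simp
    finally show ?thesis by (simp add: \<omega> query_rv_def)
  qed
  then have "?lhs = (\<integral>\<omega>. (\<Sum>m\<in>I. \<Sum>q\<in>Q l. f q * indicator (?R m q) \<omega>) \<partial>P)"
    by (intro Bochner_Integration.integral_cong) auto
  also have "\<dots> = (\<Sum>m\<in>I. \<Sum>q\<in>Q l. f q * measure P (?R m q))"
    by (intro has_bochner_integral_integral_eq has_bochner_integral_sum
        has_bochner_integral_mult_right has_bochner_integral_real_indicator R)
      (auto simp: P.emeasure_eq_measure)
  also have "\<dots> = (\<Sum>m\<in>I. \<Sum>q\<in>Q l. pquery l m q * f q) / K"
    using measure_query[OF l] by (simp add: sum_divide_distrib mult.commute)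
  finally show ?thesis .
qed

section \<open>The bound for one scheme and for the supremum\<close>

lemma download_cost_ge:
  assumes adm: "admissible K n sc" and leak: "mi_leakage K n sc \<le> \<rho>" and \<rho>: "0 \<le> \<rho>" "\<rho> \<le> 1"
  shows "log 2 (card F) * (1 / real n ^ (K - 1) +
      2 * (\<Sum>m=1..K - 1. 1 / real n ^ (m - 1) * binary_entropy_inv (1 - \<rho>))) \<le> download_cost K n sc"
proof -
  interpret core: finite_retrieval F I N Q W "answer sc" by (rule finite_retrieval_scheme[OF adm])
  define c where "c l q = real (answer_length sc l q) * log 2 (card (answer_alphabet sc))" for l q
  \<comment> \<open>The cyclic successor on \<open>{1..K}\<close>, which sends \<open>K\<close> to
    1.\<close>
  define \<sigma> where "\<sigma> m = m mod K + 1" for m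
  have \<sigma>_Suc: "(\<sigma> ^^ Suc j) m = (\<sigma> ^^ j) m mod K + 1" for j m by (simp add: \<sigma>_def)
  have \<sigma>_pow: "(\<sigma> ^^ j) m = (m - 1 + j) mod K + 1" if "m \<in> I" for j m
  proof (induction j)
    case 0
    then show ?case using that by (auto simp: le_eq_less_or_eq)
  next
    case (Suc j)
    have "((m - 1 + j) mod K + 1) mod K = (m - 1 + Suc j) mod K"
      using mod_add_left_eq[of "m - 1 + j" K 1] by (simp add: One_nat_def)
    then show ?case by (simp only: Suc \<sigma>_Suc)
  qed
  have "m mod K < K" for m
    using K by (intro mod_less_divisor) linarith
  then have "\<sigma> m \<in> I" for m
    by (simp add: \<sigma>_def Suc_le_eq flip: Suc_eq_plus1)
  then have \<sigma>I: "\<sigma> ` I \<subseteq> I" by blast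
  have "inj_on \<sigma> I"
  proof (rule inj_onI)
    fix m m' assume "m \<in> I" "m' \<in> I" "\<sigma> m = \<sigma> m'"
    then show "m = m'" using K by (cases "m = K"; cases "m' = K") (auto simp: \<sigma>_def)
  qed
  with \<sigma>I have bij: "bij_betw \<sigma> I I"
    by (simp add: bij_betw_def endo_inj_surj)
  have inj: "inj_on (\<lambda>j. (\<sigma> ^^ j) m) {..<card I}" if "m \<in> I" for m
  proof (rule inj_onI)
    fix i j assume "i \<in> {..<card I}" "j \<in> {..<card I}" "(\<sigma> ^^ i) m = (\<sigma> ^^ j) m"
    then have ij: "(m - 1 + i) mod K = (m - 1 + j) mod K" "i < K" "j < K"
      by (auto simp: \<sigma>_pow[OF that])
    have *: "i' = j'" if "i' \<le> j'" "j' < K" "(m - 1 + i') mod K = (m - 1 + j') mod K" for i' j'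
    proof -
      \<comment> \<open>The difference of two positions below \<open>K\<close> is a multiple of
        \<open>K\<close>, hence 0.\<close>
      have "K dvd (m - 1 + j') - (m - 1 + i')"
        using that by (subst mod_eq_dvd_iff_nat[symmetric]) auto
      then show ?thesis using that dvd_imp_le[of K "j' - i'"] by (cases "i' < j'") auto
    qed
    show "i = j" using *[of i j] *[of j i] ij by (cases "i \<le> j") auto
  qed
  have c: "log 2 (card (answer sc l q ` \<Omega>)) \<le> c l q" if "l \<in> N" "q \<in> Q l" for l q
  proof -
    have A: "finite (answer_alphabet sc)" "answer_alphabet sc \<noteq> {}"
      using scheme by (auto simp: is_ir_scheme_def)
    have "answer sc l q ` \<Omega> \<subseteq> words (answer_alphabet sc) (answer_length sc l q)"
      using answer_in[OF that] by auto
    then have "card (answer sc l q ` \<Omega>) \<le> card (answer_alphabet sc) ^ answer_length sc l q"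
      using A card_mono[OF _ \<open>answer sc l q ` \<Omega> \<subseteq> _\<close>]
      by (simp add: words_def finite_lists_length_eq card_lists_length_eq)
    moreover have "0 < card (answer sc l q ` \<Omega>)"
      using finite_\<Omega> \<Omega>_nonempty by (auto simp: card_gt_0_iff)
    ultimately have "log 2 (card (answer sc l q ` \<Omega>)) \<le>
        log 2 (card (answer_alphabet sc) ^ answer_length sc l q)"
      by (intro log_mono of_nat_mono) auto
    also have "\<dots> = c l q"
      using A by (simp add: c_def log_nat_power card_gt_0_iff)
    finally show ?thesis .
  qed
  have marg: "core.marg l m q = pquery l m q" if "l \<in> N" "m \<in> I" for l m q
    by (rule marg_eq[OF adm that])
  \<comment> \<open>Clearing the means over servers and indices from the leakage gives the factor
    \<open>card N * card I\<close>.\<close>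
  have "(\<Sum>l\<in>N. \<Sum>m\<in>I. \<Sum>q\<in>Q l.
        core.marg l m q * log 2 (core.marg l m q / ((\<Sum>m'\<in>I. core.marg l m' q) / card I))) =
      (\<Sum>l\<in>N. \<Sum>m\<in>I. \<Sum>q\<in>Q l.
        pquery l m q * log 2 (pquery l m q / ((\<Sum>m'\<in>I. pquery l m' q) / K)))"
    by (intro sum.cong refl arg_cong2[where f = "(*)"] arg_cong2[where f = log]
        arg_cong2[where f = "(/)"] marg) simp_all
  also have "\<dots> = (\<Sum>l\<in>N. K * mutual_info P index_rv (query_rv sc l))"
    using K by (intro sum.cong refl) (simp only: mutual_info_eq, simp)
  also have "\<dots> = K * (\<Sum>l\<in>N. mutual_info P index_rv (query_rv sc l))"
    by (rule sum_distrib_left[symmetric])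
  also have "\<dots> = mi_leakage K n sc * (card N * card I)"
    using n by (simp add: mi_leakage_def)
  also have "\<dots> \<le> \<rho> * (card N * card I)"
    using leak by (intro mult_right_mono) auto
  finally have "log 2 (card F) * (1 / card N ^ (card I - 1) +
      2 * (\<Sum>i<card I - 1. 1 / card N ^ i * binary_entropy_inv (1 - \<rho>))) * card I \<le>
    (\<Sum>m\<in>I. \<Sum>l\<in>N. \<Sum>q\<in>Q l. core.marg l m q * c l q)"
    using bij inj c \<rho> by (intro core.cost_lower_bound) auto
  also have "\<dots> = (\<Sum>l\<in>N. \<Sum>m\<in>I. \<Sum>q\<in>Q l. pquery l m q * c l q)"
    by (subst sum.swap) (intro sum.cong refl arg_cong2[where f = "(*)"] marg)
  also have "\<dots> = download_cost K n sc * K"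
  proof -
    have "log 2 (card (answer_alphabet sc)) *
        (\<integral>\<omega>. real (answer_length sc l (query_rv sc l \<omega>)) \<partial>P) * K =
      (\<Sum>m\<in>I. \<Sum>q\<in>Q l. pquery l m q * c l q)" if "l \<in> N" for l
    proof -
      have cancel: "a * (S / real K) * K = a * S" for a S :: real using K by simp
      show ?thesis
        unfolding expectation_query[OF that, of "\<lambda>q. real (answer_length sc l q)"] cancel
        by (simp only: c_def sum_distrib_left mult_ac)
    qed
    then show ?thesis
      by (simp add: download_cost_def sum_distrib_left sum_distrib_right)
  qed
  finally have "log 2 (card F) * (1 / real n ^ (K - 1) +
      2 * (\<Sum>i<K - 1. 1 / real n ^ i * binary_entropy_inv (1 - \<rho>))) \<le> download_cost K n sc"
    using K by simp
  \<comment> \<open>Index shift \<open>m = i + 1\<close>.\<close>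
  moreover have "(\<Sum>m=1..K - 1. 1 / real n ^ (m - 1) * binary_entropy_inv (1 - \<rho>)) =
      (\<Sum>i<K - 1. 1 / real n ^ i * binary_entropy_inv (1 - \<rho>))"
    by (simp add: sum.atLeast1_atMost_eq One_nat_def)
  ultimately show ?thesis by simp
qed

lemma rate_le:
  assumes "admissible K n sc" "mi_leakage K n sc \<le> \<rho>" "0 \<le> \<rho>" "\<rho> \<le> 1"
  shows "rate K n sc \<le> inverse (1 / real n ^ (K - 1) +
      2 * (\<Sum>m=1..K - 1. 1 / real n ^ (m - 1) * binary_entropy_inv (1 - \<rho>)))"
proof -
  define B where "B = 1 / real n ^ (K - 1) +
      2 * (\<Sum>m=1..K - 1. 1 / real n ^ (m - 1) * binary_entropy_inv (1 - \<rho>))"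
  have "0 \<le> (\<Sum>m=1..K - 1. 1 / real n ^ (m - 1) * binary_entropy_inv (1 - \<rho>))"
    using assms binary_entropy_inv(1)[of "1 - \<rho>"] by (intro sum_nonneg mult_nonneg_nonneg) auto
  moreover have "0 < 1 / real n ^ (K - 1)" using n by simp
  \<comment> \<open>Makes the download cost positive, so that the rate is a genuine quotient and not
    the value of division by 0.\<close>
  ultimately have B: "0 < B" unfolding B_def by linarith
  have L: "log 2 (card F) > 0" using card_F_ge_2 by simp
  have "card (file_alphabet sc) > 0"
    using scheme by (simp add: is_ir_scheme_def)
  then have LF: "log 2 (card F) = file_length sc * log 2 (card (file_alphabet sc))"
    by (simp add: card_F log_nat_power)
  have "log 2 (card F) * B \<le> download_cost K n sc"
    unfolding B_def by (rule download_cost_ge[OF assms])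
  moreover have "0 < log 2 (card F) * B" using L B by simp
  ultimately have "log 2 (card F) / download_cost K n sc \<le> log 2 (card F) / (log 2 (card F) * B)"
    using L by (intro divide_left_mono) auto
  moreover have "log 2 (card F) / (log 2 (card F) * B) = inverse B"
    using L by (simp add: field_simps)
  ultimately show ?thesis by (simp only: rate_def LF[symmetric] B_def[symmetric])
qed

end

theorem theorem8:
  fixes K n :: nat and \<rho> :: real
  assumes "K \<ge> 1" and "n \<ge> 2" and "0 \<le> \<rho>" and "\<rho> \<le> 1"
  shows "max_rate_mi TYPE(('s, 'q, 'x, 'a) ir_scheme) K n \<rho> \<le>
    ereal (inverse (1 / real n ^ (K - 1) +
      2 * (\<Sum>m=1..K - 1. 1 / real n ^ (m - 1) * binary_entropy_inv (1 - \<rho>))))"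
  unfolding max_rate_mi_def
proof (rule SUP_least)
  fix sc :: "('s, 'q, 'x, 'a) ir_scheme"
  assume "sc \<in> {sc. is_ir_scheme K n sc \<and> admissible K n sc \<and> mi_leakage K n sc \<le> \<rho>}"
  then have sc: "is_ir_scheme K n sc" "admissible K n sc" "mi_leakage K n sc \<le> \<rho>" by auto
  interpret finite_ir_scheme K n sc
    using assms sc by unfold_locales (auto simp: admissible_def)
  show "ereal (rate K n sc) \<le> ereal (inverse (1 / real n ^ (K - 1) +
      2 * (\<Sum>m=1..K - 1. 1 / real n ^ (m - 1) * binary_entropy_inv (1 - \<rho>))))"
    using rate_le[OF sc(2,3) assms(3,4)] by simp
qed

end
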